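(* Let $\mathcal G$ be a groupoid (in the sense of the standing conventions below). Let $M\in\mathbb N$ and let $(\epsilon_n)_{n\in\mathbb N}$ be a decreasing sequence of positive numbers with $\lim_{n\to\infty}\epsilon_n=0$. Suppose $\mathcal G$ admits a Følner sequence $\mathcal S=(S_n)_{n\in\mathbb N}$ such that, for every $n$, the normal set $S_n$ is $(M,\epsilon_n)$-good and has $1$-controlled height. Then $\mathcal G$ is almost finite in measure.
   Context: Standing conventions: a groupoid $\mathcal G$ is a $\sigma$-compact, locally compact, Hausdorff, étale groupoid which is ample (its topology has a basis of compact open bisections) and whose unit space $\mathcal G^{(0)}$ is compact; $s,r$ denote source and range. For subsets $A,B\subseteq\mathcal G$, $AB=\{ab: a\in A, b\in B, s(a)=r(b)\}$, and for $u\in\mathcal G^{(0)}$, $Au=\{a\in A: s(a)=u\}$. A bisection is a set on which $s$ and $r$ are injective (an open bisection is open with $s,r$ restricting to homeomorphisms onto open sets). A multisection is a finite family $\{C_{i,j}: i,j\in F\}$ of bisections with $C_{i,j}C_{j,k}=C_{i,k}$ for all $i,j,k\in F$ and with $\{C_{i,i}:i\in F\}$ a pairwise disjoint family of subsets of $\mathcal G^{(0)}$ (the levels); it is compact open if all $C_{i,j}$ are. A castle is a finite family of multisections $\{C^l_{i,j}: i,j\in F_l\}$, $l\in I$, with $C^l_{i,j}C^{l'}_{i',j'}=\emptyset$ whenever $l\neq l'$. A compact open subgroupoid $\mathcal H$ is elementary if $\mathcal H=\bigsqcup_{l\in I}\bigsqcup_{i,j\in F_l}C^l_{i,j}$ for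 some compact open castle; then $\mathcal H^{(0)}$ is the union of its levels. $M(\mathcal G)$ is the set of $\mathcal G$-invariant Borel probability measures on $\mathcal G^{(0)}$ (i.e. $\mu(s(B))=\mu(r(B))$ for every compact open bisection $B$). Conventions: $\inf_\emptyset=+\infty$, $\sup_\emptyset=0$. For compact $K\subseteq\mathcal G$ and $\epsilon>0$, a finite nonempty $F\subseteq\mathcal G$ is $(K,\epsilon)$-Følner if $|KF\setminus F|\le\epsilon|F|$. A normal set is a compact open $S\subseteq\mathcal G$ together with compact open multisections $\mathcal C_l=\{C^l_{i,j}:i,j\in F_l\}$, $l=1,\dots,m$, and chosen indices $i_l\in F_l$, such that $S=\bigcup_{l=1}^m\bigsqcup_{i\in F_l}C^l_{i,i_l}$ and $\mathcal G^{(0)}=\bigsqcup_{l=1}^m C^l_{i_l,i_l}$ (disjoint union). It is a normal $(K,\epsilon)$-Følner set if in addition $Su$ is $(K,\epsilon)$-Følner for every $u\in\mathcal G^{(0)}$. A Følner sequence for $\mathcal G$ is a sequence $(S_n)$ of normal sets such that for every compact $K\subseteq\mathcal G$, $\sup_{u\in\mathcal G^{(0)}}|KS_nu\setminus S_nu|/|S_nu|\to0$ as $n\to\infty$. For a normal set $S$ with the structure above, its height is $h(S)=\min_{1\le l\le m}|F_l|$. It has $N$-controlled height ($N\in\mathbb N_+$) if $|F_l|\le N\,h(S)$ for all $l$. It is $(M,\epsilon)$-good if there are injections $f_l:\{0,\dots,h(S)-1\}\to F_l$ ($1\le l\le m$) with $f_l(0)=i_l$ such that: (a) $\inf_{\mu\in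 M(\mathcal G)}\mu\big(\bigcup_{l=1}^m C^l_{f_l(k),f_l(k)}\big)\ge1-\epsilon$ for every $0\le k\le h(S)-1$; and (b) there is $L\subseteq\{1,\dots,m\}$ with $\inf_{\mu\in M(\mathcal G)}\mu\big(\bigsqcup_{l\in L}C^l_{i_l,i_l}\big)>1-\epsilon$ such that for every $0\le k\le h(S)-1$ the family $\{C^l_{f_l(k),f_l(k)}: l\in L\}$ can be written as a union of at most $M$ subfamilies each consisting of pairwise disjoint sets. $\mathcal G$ is almost finite in measure if for every compact $K\subseteq\mathcal G$ and $\epsilon>0$ there is a compact open elementary subgroupoid $\mathcal H$ with $|K\mathcal Hu\setminus\mathcal Hu|<\epsilon|\mathcal Hu|$ for every $u\in\mathcal H^{(0)}$ and $\mu(\mathcal H^{(0)})>1-\epsilon$ for every $\mu\in M(\mathcal G)$. *)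

theory Defs
  imports "HOL-Probability.Probability"
begin

text \<open>A groupoid is represented with carrier the whole type 'g (a Hausdorff topological
space via the class t2_space); the record bundles source, range, multiplication and inverse.
Multiplication is total as a HOL function but only meaningful on composable pairs.\<close>

record 'g groupoid =
  src :: "'g \<Rightarrow> 'g"
  rng :: "'g \<Rightarrow> 'g"
  mul :: "'g \<Rightarrow> 'g \<Rightarrow> 'g"
  ginv :: "'g \<Rightarrow> 'g"

definition units :: "('g, 'z) groupoid_scheme \<Rightarrow> 'g set" where
  "units G = {u. src G u = u}"

definition groupoid_alg :: "('g, 'z) groupoid_scheme \<Rightarrow> bool" where
  "groupoid_alg G \<longleftrightarrow>
     (\<forall>a. src G (src G a) = src G a \<and> rng G (src G a) = src G a \<and>
          src G (rng G a) = rng G a \<and> rng G (rng G a) = rng G a) \<and>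
     (\<forall>a b. src G a = rng G b \<longrightarrow>
          src G (mul G a b) = src G b \<and> rng G (mul G a b) = rng G a) \<and>
     (\<forall>a b c. src G a = rng G b \<longrightarrow> src G b = rng G c \<longrightarrow>
          mul G (mul G a b) c = mul G a (mul G b c)) \<and>
     (\<forall>a. mul G (rng G a) a = a \<and> mul G a (src G a) = a) \<and>
     (\<forall>a. src G (ginv G a) = rng G a \<and> rng G (ginv G a) = src G a \<and>
          mul G a (ginv G a) = rng G a \<and> mul G (ginv G a) a = src G a)"

definition bisection :: "('g, 'z) groupoid_scheme \<Rightarrow> 'g set \<Rightarrow> bool" where
  "bisection G B \<longleftrightarrow> inj_on (src G) B \<and> inj_on (rng G) B"

definition local_homeo :: "('g::topological_space \<Rightarrow> 'g) \<Rightarrow> bool" where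
  "local_homeo f \<longleftrightarrow> (\<forall>x. \<exists>U. open U \<and> x \<in> U \<and> open (f ` U) \<and>
       (\<exists>g. homeomorphism U (f ` U) f g))"

definition ample_groupoid :: "('g::t2_space, 'z) groupoid_scheme \<Rightarrow> bool" where
  "ample_groupoid G \<longleftrightarrow>
     groupoid_alg G \<and>
     continuous_on {p. src G (fst p) = rng G (snd p)} (\<lambda>p. mul G (fst p) (snd p)) \<and>
     continuous_on UNIV (ginv G) \<and>
     continuous_on UNIV (src G) \<and> continuous_on UNIV (rng G) \<and>
     local_homeo (src G) \<and> local_homeo (rng G) \<and>
     (\<forall>x::'g. \<exists>U K :: 'g set. open U \<and> compact K \<and> x \<in> U \<and> U \<subseteq> K) \<and>
     (\<exists>K :: nat \<Rightarrow> 'g set. (\<forall>n. compact (K n)) \<and> (\<Union>n. K n) = UNIV) \<and>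
     (\<forall>W x. open W \<and> x \<in> W \<longrightarrow>
        (\<exists>B. compact B \<and> open B \<and> bisection G B \<and> x \<in> B \<and> B \<subseteq> W)) \<and>
     compact (units G)"

definition setmul :: "('g, 'z) groupoid_scheme \<Rightarrow> 'g set \<Rightarrow> 'g set \<Rightarrow> 'g set" where
  "setmul G A B = {mul G a b | a b. a \<in> A \<and> b \<in> B \<and> src G a = rng G b}"

definition fib :: "('g, 'z) groupoid_scheme \<Rightarrow> 'g set \<Rightarrow> 'g \<Rightarrow> 'g set" where
  "fib G A u = {a \<in> A. src G a = u}"

definition inv_measures :: "('g::t2_space, 'z) groupoid_scheme \<Rightarrow> 'g measure set" where
  "inv_measures G = {\<mu>. prob_space \<mu> \<and> sets \<mu> = sets (restrict_space borel (units G)) \<and>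
      (\<forall>B. compact B \<and> open B \<and> bisection G B \<longrightarrow>
           measure \<mu> (src G ` B) = measure \<mu> (rng G ` B))}"

definition multisection ::
  "('g, 'z) groupoid_scheme \<Rightarrow> nat set \<Rightarrow> (nat \<Rightarrow> nat \<Rightarrow> 'g set) \<Rightarrow> bool" where
  "multisection G F C \<longleftrightarrow> finite F \<and>
     (\<forall>i\<in>F. \<forall>j\<in>F. bisection G (C i j)) \<and>
     (\<forall>i\<in>F. \<forall>j\<in>F. \<forall>k\<in>F. setmul G (C i j) (C j k) = C i k) \<and>
     (\<forall>i\<in>F. C i i \<subseteq> units G) \<and>
     disjoint_family_on (\<lambda>i. C i i) F"

definition co_multisection ::
  "('g::topological_space, 'z) groupoid_scheme \<Rightarrow> nat set \<Rightarrow> (nat \<Rightarrow> nat \<Rightarrow> 'g set) \<Rightarrow> bool" where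
  "co_multisection G F C \<longleftrightarrow> multisection G F C \<and>
     (\<forall>i\<in>F. \<forall>j\<in>F. compact (C i j) \<and> open (C i j))"

definition unit_space_of :: "('g, 'z) groupoid_scheme \<Rightarrow> 'g set \<Rightarrow> 'g set" where
  "unit_space_of G H = H \<inter> units G"

definition elementary_subgroupoid ::
  "('g::topological_space, 'z) groupoid_scheme \<Rightarrow> 'g set \<Rightarrow> bool" where
  "elementary_subgroupoid G H \<longleftrightarrow>
     compact H \<and> open H \<and>
     (\<forall>a\<in>H. \<forall>b\<in>H. src G a = rng G b \<longrightarrow> mul G a b \<in> H) \<and>
     (\<forall>a\<in>H. ginv G a \<in> H) \<and>
     (\<exists>(I :: nat set) (F :: nat \<Rightarrow> nat set) (C :: nat \<Rightarrow> nat \<Rightarrow> nat \<Rightarrow> 'g set).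
        finite I \<and>
        (\<forall>l\<in>I. co_multisection G (F l) (C l)) \<and>
        (\<forall>l\<in>I. \<forall>l'\<in>I. l \<noteq> l' \<longrightarrow>
           (\<forall>i\<in>F l. \<forall>j\<in>F l. \<forall>i'\<in>F l'. \<forall>j'\<in>F l'.
               setmul G (C l i j) (C l' i' j') = {})) \<and>
        H = (\<Union>l\<in>I. \<Union>i\<in>F l. \<Union>j\<in>F l. C l i j))"

definition almost_finite_in_measure :: "('g::t2_space, 'z) groupoid_scheme \<Rightarrow> bool" where
  "almost_finite_in_measure G \<longleftrightarrow>
     (\<forall>K \<epsilon>. compact K \<and> \<epsilon> > 0 \<longrightarrow>
        (\<exists>H. elementary_subgroupoid G H \<and>
           (\<forall>u\<in>unit_space_of G H.
              real (card (setmul G K (fib G H u) - fib G H u)) < \<epsilon> * real (card (fib G H u))) \<and>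
           (\<forall>\<mu>\<in>inv_measures G. measure \<mu> (unit_space_of G H) > 1 - \<epsilon>)))"

text \<open>A normal set together with its chosen structure: S, the number m of multisections
(indexed by l = 1..m), index sets F l, the multisections C l, and the chosen indices i0 l.\<close>

record 'g normal_data =
  nS :: "'g set"
  nm :: nat
  nF :: "nat \<Rightarrow> nat set"
  nC :: "nat \<Rightarrow> nat \<Rightarrow> nat \<Rightarrow> 'g set"
  ni :: "nat \<Rightarrow> nat"

definition normal_set ::
  "('g::topological_space, 'z) groupoid_scheme \<Rightarrow> 'g normal_data \<Rightarrow> bool" where
  "normal_set G N \<longleftrightarrow>
     compact (nS N) \<and> open (nS N) \<and>
     (\<forall>l\<in>{1..nm N}. co_multisection G (nF N l) (nC N l) \<and> ni N l \<in> nF N l) \<and>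
     nS N = (\<Union>l\<in>{1..nm N}. \<Union>i\<in>nF N l. nC N l i (ni N l)) \<and>
     units G = (\<Union>l\<in>{1..nm N}. nC N l (ni N l) (ni N l)) \<and>
     disjoint_family_on (\<lambda>l. nC N l (ni N l) (ni N l)) {1..nm N}"

definition folner_set :: "('g, 'z) groupoid_scheme \<Rightarrow> 'g set \<Rightarrow> real \<Rightarrow> 'g set \<Rightarrow> bool" where
  "folner_set G K \<epsilon> F \<longleftrightarrow> finite F \<and> F \<noteq> {} \<and>
     real (card (setmul G K F - F)) \<le> \<epsilon> * real (card F)"

definition normal_folner_set ::
  "('g::topological_space, 'z) groupoid_scheme \<Rightarrow> 'g set \<Rightarrow> real \<Rightarrow> 'g normal_data \<Rightarrow> bool" where
  "normal_folner_set G K \<epsilon> N \<longleftrightarrow> normal_set G N \<and>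
     (\<forall>u\<in>units G. folner_set G K \<epsilon> (fib G (nS N) u))"

definition folner_sequence ::
  "('g::topological_space, 'z) groupoid_scheme \<Rightarrow> (nat \<Rightarrow> 'g normal_data) \<Rightarrow> bool" where
  "folner_sequence G S \<longleftrightarrow> (\<forall>n. normal_set G (S n)) \<and>
     (\<forall>K. compact K \<longrightarrow>
        ((\<lambda>n. SUP u\<in>units G. ereal (real (card (setmul G K (fib G (nS (S n)) u) - fib G (nS (S n)) u))
                                    / real (card (fib G (nS (S n)) u))))
          \<longlonglongrightarrow> 0))"

definition height :: "'g normal_data \<Rightarrow> nat" where
  "height N = Min ((\<lambda>l. card (nF N l)) ` {1..nm N})"

definition controlled_height :: "nat \<Rightarrow> 'g normal_data \<Rightarrow> bool" where
  "controlled_height K N \<longleftrightarrow> (\<forall>l\<in>{1..nm N}. card (nF N l) \<le> K * height N)"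

text \<open>Infima over M(G) are taken in the extended reals, so that the infimum over the
empty set is +infinity.\<close>

definition good ::
  "('g::t2_space, 'z) groupoid_scheme \<Rightarrow> nat \<Rightarrow> real \<Rightarrow> 'g normal_data \<Rightarrow> bool" where
  "good G M \<epsilon> N \<longleftrightarrow>
     (\<exists>f :: nat \<Rightarrow> nat \<Rightarrow> nat.
        (\<forall>l\<in>{1..nm N}. inj_on (f l) {..<height N} \<and> f l ` {..<height N} \<subseteq> nF N l \<and>
            f l 0 = ni N l) \<and>
        (\<forall>k<height N. (INF \<mu>\<in>inv_measures G.
            ereal (measure \<mu> (\<Union>l\<in>{1..nm N}. nC N l (f l k) (f l k)))) \<ge> ereal (1 - \<epsilon>)) \<and>
        (\<exists>L. L \<subseteq> {1..nm N} \<and>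
            (INF \<mu>\<in>inv_measures G.
               ereal (measure \<mu> (\<Union>l\<in>L. nC N l (ni N l) (ni N l)))) > ereal (1 - \<epsilon>) \<and>
            (\<forall>k<height N. \<exists>P :: nat \<Rightarrow> nat.
               (\<forall>l\<in>L. P l < M) \<and>
               (\<forall>l\<in>L. \<forall>l'\<in>L. l \<noteq> l' \<and> P l = P l' \<longrightarrow>
                   nC N l (f l k) (f l k) \<inter> nC N l' (f l' k) (f l' k) = {}))))"

end

theory Submission
  imports Defs
begin

text \<open>The proof is an Ornstein--Weiss quasi-tiling argument. Controlled height 1 makes all tiles \<open>Su\<close>
of a normal set \<open>S\<close> equally large, of size \<open>h\<close>, and the first half of goodness says that the \<open>k\<close>-th
points of the tiles cover almost every unit almost once, for each \<open>k < h\<close>. Running through the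
multisections of \<open>S\<close> and adding every tile that meets the part already covered in a proportion less
than \<open>\<alpha>\<close> (trimmed to be disjoint from it) yields a covered set \<open>A\<close> that meets each tile in a
proportion at least \<open>\<alpha>\<close>. If the process starts from a set that is almost invariant under \<open>S\<^sup>-\<^sup>1\<close>, then
nearly every uncovered base point has a tile disjoint from that set, so \<open>A\<close> gains almost a proportion \<open>\<alpha>\<close> of the
uncovered part. Iterating this with Folner sets that are ever more invariant (the most invariant
one is used first) leaves a remainder of measure about \<open>(1 - \<alpha>)\<^sup>m\<close> after \<open>m\<close> rounds, uniformly over
the invariant measures.\<close>

text \<open>The obstacle is that a tile tolerates only a small loss: once a large part of it is
  trimmed away, it need not be almost invariant under \<open>K\<close> any more. A tile that
  overlaps the covered set too much is therefore dropped, and dropping is harmless because a dropped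
  tile is itself a witness that the covered set meets it in proportion \<alpha>. So one threshold
  serves both purposes, but a single round gains only about \<alpha>, which forces several rounds.
  In a later round only newly covered points may count as gain, so the double count is made over
  uncovered base points whose tiles avoid the older set \<open>D\<close>. The other uncovered base
  points lie in \<open>S\<^sup>-\<^sup>1 D - D\<close>. Hence \<open>S\<close> has to be fixed
  before \<open>D\<close> is built, and small boundary of \<open>D\<close> with respect to an
  arbitrary compact open set has to be part of the induction claim. This boundary stays small
  because the mass leaving the tiles is at most \<delta> times the total mass of the untrimmed
  tiles, and that is at most 2: the trimmed tiles are disjoint and each keeps at least half of its
  points.\<close>

definition compact_open :: "'a::topological_space set \<Rightarrow> bool" where
  "compact_open X \<longleftrightarrow> compact X \<and> open X"

lemma compact_open_empty [simp]: "compact_open {}"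
  by (simp add: compact_open_def)

lemma compact_open_Un: "compact_open X \<Longrightarrow> compact_open Y \<Longrightarrow> compact_open (X \<union> Y)"
  by (auto simp: compact_open_def)

lemma compact_open_UN: "finite I \<Longrightarrow> (\<And>i. i \<in> I \<Longrightarrow> compact_open (X i)) \<Longrightarrow> compact_open (\<Union>i\<in>I. X i)"
  by (auto simp: compact_open_def)

lemma compact_open_Int:
  fixes X Y :: "'a::t2_space set"
  shows "compact_open X \<Longrightarrow> compact_open Y \<Longrightarrow> compact_open (X \<inter> Y)"
  by (auto simp: compact_open_def compact_Int)

lemma compact_open_Diff:
  fixes X Y :: "'a::t2_space set"
  shows "compact_open X \<Longrightarrow> compact_open Y \<Longrightarrow> compact_open (X - Y)"
  by (auto simp: compact_open_def compact_diff open_Diff compact_imp_closed)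

lemma compact_open_INT_Int:
  fixes Y :: "'a::t2_space set"
  assumes "finite I" "compact_open Y" "\<And>i. i \<in> I \<Longrightarrow> compact_open (X i)"
  shows "compact_open (Y \<inter> (\<Inter>i\<in>I. X i))"
  using assms
proof (induction I)
  case (insert i I)
  have "Y \<inter> (\<Inter>i\<in>insert i I. X i) = (Y \<inter> (\<Inter>i\<in>I. X i)) \<inter> X i" by auto
  then show ?case using insert by (simp add: compact_open_Int)
qed simp

text \<open>The preimage of \<open>Y\<close> is clopen but need not be compact; intersecting it with
  \<open>X\<close> restores compactness. Hence the recurring form of sets of arrows cut by a
  condition on source or range.\<close>

lemma compact_open_Int_vimage:
  fixes f :: "'a::t2_space \<Rightarrow> 'b::t2_space"
  assumes f: "continuous_on UNIV f" and "compact_open X" "compact_open Y"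
  shows "compact_open (X \<inter> f -` Y)"
proof -
  have "open (f -` Y)" "closed (f -` Y)"
    using assms by (simp_all add: compact_open_def compact_imp_closed open_vimage closed_vimage)
  then show ?thesis using assms by (auto simp: compact_open_def compact_Int_closed)
qed

lemma local_homeo_open_image:
  assumes f: "local_homeo f" and V: "open V"
  shows "open (f ` V)"
proof (subst open_subopen, intro ballI)
  fix y assume "y \<in> f ` V"
  then obtain x where x: "x \<in> V" "y = f x" by auto
  obtain U g where U: "open U" "x \<in> U" "open (f ` U)" and h: "homeomorphism U (f ` U) f g"
    using f unfolding local_homeo_def by meson
  have "openin (top_of_set (f ` U)) (f ` (U \<inter> V))"
    using homeomorphism_imp_open_map[OF h] V by auto
  then have "open (f ` (U \<inter> V))" using U(3) by (simp add: openin_open_eq)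
  then show "\<exists>T. open T \<and> y \<in> T \<and> T \<subseteq> f ` V" using x U by blast
qed

text \<open>Each new member is kept whole and subtracted from the earlier pieces. With
  \<open>P\<close> the compact open bisections, which are stable under differences, this turns a
  cover into a partition whose pieces can be counted.\<close>

lemma finite_disjoint_refinement:
  assumes "finite \<D>"
    and "\<And>B. B \<in> \<D> \<Longrightarrow> P B" and "\<And>A B. P A \<Longrightarrow> P B \<Longrightarrow> P (A - B)"
  shows "\<exists>\<X>. finite \<X> \<and> disjoint \<X> \<and> \<Union>\<X> = \<Union>\<D> \<and> (\<forall>X\<in>\<X>. P X)"
  using assms(1,2)
proof (induction \<D>)
  case empty
  then show ?case by (intro exI[of _ "{}"]) auto
next
  case (insert B \<D>)
  then obtain \<X> where X: "finite \<X>" "disjoint \<X>" "\<Union>\<X> = \<Union>\<D>" "\<forall>X\<in>\<X>. P X" by auto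
  let ?Y = "insert B ((\<lambda>X. X - B) ` \<X>)"
  have "disjoint ?Y"
  proof (rule disjointI)
    fix C D assume "C \<in> ?Y" "D \<in> ?Y" "C \<noteq> D"
    moreover have "(E - B) \<inter> (E' - B) = {}" if "E \<in> \<X>" "E' \<in> \<X>" "E - B \<noteq> E' - B" for E E'
      using disjointD[OF X(2) that(1,2)] that(3) by blast
    ultimately show "C \<inter> D = {}" by blast
  qed
  then show ?case
    using X insert assms(3) by (intro exI[of _ ?Y]) auto
qed

section \<open>Ample groupoids\<close>

locale ample =
  fixes G :: "('g::t2_space) groupoid"
  assumes ample: "ample_groupoid G"
begin

abbreviation "s \<equiv> src G"
abbreviation "r \<equiv> rng G"
abbreviation gmul (infixl "\<odot>" 70) where "a \<odot> b \<equiv> mul G a b"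

lemma alg: "groupoid_alg G" using ample by (simp add: ample_groupoid_def)

lemma s_s [simp]: "s (s a) = s a" and r_s [simp]: "r (s a) = s a"
  and s_r [simp]: "s (r a) = r a" and r_r [simp]: "r (r a) = r a"
  and s_mul [simp]: "s a = r b \<Longrightarrow> s (a \<odot> b) = s b"
  and r_mul [simp]: "s a = r b \<Longrightarrow> r (a \<odot> b) = r a"
  and mul_assoc: "s a = r b \<Longrightarrow> s b = r c \<Longrightarrow> (a \<odot> b) \<odot> c = a \<odot> (b \<odot> c)"
  and r_mul_id [simp]: "r a \<odot> a = a" and mul_s_id [simp]: "a \<odot> s a = a"
  and s_ginv [simp]: "s (ginv G a) = r a" and r_ginv [simp]: "r (ginv G a) = s a"
  and mul_ginv [simp]: "a \<odot> ginv G a = r a" and ginv_mul [simp]: "ginv G a \<odot> a = s a"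
  using alg unfolding groupoid_alg_def by blast+

lemma s_unit: "u \<in> units G \<Longrightarrow> s u = u" by (simp add: units_def)
lemma r_unit: "u \<in> units G \<Longrightarrow> r u = u" using r_s[of u] by (simp add: units_def)
lemma s_in_units [simp]: "s a \<in> units G" by (simp add: units_def)
lemma r_in_units [simp]: "r a \<in> units G" by (simp add: units_def)

lemma mul_mul_ginv: "s a = r g \<Longrightarrow> (a \<odot> g) \<odot> ginv G g = a"
  by (metis mul_assoc mul_ginv mul_s_id r_ginv)

lemma mul_ginv_mul: "s a = s g \<Longrightarrow> (a \<odot> ginv G g) \<odot> g = a"
  by (metis mul_assoc ginv_mul mul_s_id r_ginv s_ginv)

lemma ginv_mul_mul: "s a = r b \<Longrightarrow> ginv G a \<odot> (a \<odot> b) = b"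
  by (metis mul_assoc ginv_mul r_mul_id s_ginv)

lemma mul_ginv_cancel: "r a = r c \<Longrightarrow> a \<odot> (ginv G a \<odot> c) = c"
  by (metis mul_assoc mul_ginv r_mul_id r_ginv s_ginv)

lemma ginv_unique: "s a = r c \<Longrightarrow> a \<odot> c = s c \<Longrightarrow> a = ginv G c"
  by (metis mul_mul_ginv r_ginv r_mul_id)

lemma continuous_s: "continuous_on X s"
  by (rule continuous_on_subset[OF _ subset_UNIV]) (use ample in \<open>simp add: ample_groupoid_def\<close>)

lemma continuous_r: "continuous_on X r"
  by (rule continuous_on_subset[OF _ subset_UNIV]) (use ample in \<open>simp add: ample_groupoid_def\<close>)

lemma continuous_ginv: "continuous_on X (ginv G)"
  by (rule continuous_on_subset[OF _ subset_UNIV]) (use ample in \<open>simp add: ample_groupoid_def\<close>)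

lemma continuous_mul:
  assumes "Z \<subseteq> {p. s (fst p) = r (snd p)}"
  shows "continuous_on Z (\<lambda>p. fst p \<odot> snd p)"
  by (rule continuous_on_subset[OF _ assms]) (use ample in \<open>simp add: ample_groupoid_def\<close>)

lemma ample_basis:
  assumes "open V" "x \<in> V"
  obtains B where "compact_open B" "bisection G B" "x \<in> B" "B \<subseteq> V"
proof -
  have "\<exists>B. compact B \<and> open B \<and> bisection G B \<and> x \<in> B \<and> B \<subseteq> V"
    using ample assms by (simp add: ample_groupoid_def)
  then show ?thesis using that by (auto simp: compact_open_def)
qed

lemma compact_open_s: "compact_open X \<Longrightarrow> compact_open (s ` X)"
  and compact_open_r: "compact_open X \<Longrightarrow> compact_open (r ` X)"
  using ample continuous_s continuous_r
  by (simp_all add: ample_groupoid_def compact_open_def compact_continuous_image local_homeo_open_image)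

lemma compact_open_s_vimage: "compact_open X \<Longrightarrow> compact_open Y \<Longrightarrow> compact_open (X \<inter> s -` Y)"
  and compact_open_r_vimage: "compact_open X \<Longrightarrow> compact_open Y \<Longrightarrow> compact_open (X \<inter> r -` Y)"
  using compact_open_Int_vimage continuous_s continuous_r by blast+

lemma ginv_ginv [simp]: "ginv G (ginv G a) = a"
  by (metis ginv_unique mul_ginv s_ginv r_ginv)

lemma compact_open_ginv:
  assumes "compact_open X" shows "compact_open (ginv G ` X)"
proof -
  have "ginv G ` X = ginv G -` X" by (force simp: image_iff)
  moreover have "open (ginv G -` X)"
    using assms continuous_ginv by (simp add: compact_open_def open_vimage)
  moreover have "compact (ginv G ` X)"
    using assms continuous_ginv
    by (simp add: compact_open_def compact_continuous_image)
  ultimately show ?thesis by (simp add: compact_open_def)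
qed

lemma bisection_subset: "bisection G B \<Longrightarrow> A \<subseteq> B \<Longrightarrow> bisection G A"
  by (auto simp: bisection_def intro: inj_on_subset)

lemma compact_cover_bisections:
  assumes "compact X" "X \<subseteq> V" "open V"
  shows "\<exists>\<D>. finite \<D> \<and> X \<subseteq> \<Union>\<D> \<and> (\<forall>B\<in>\<D>. compact_open B \<and> bisection G B \<and> B \<subseteq> V)"
proof -
  let ?\<B> = "{B. compact_open B \<and> bisection G B \<and> B \<subseteq> V}"
  have "X \<subseteq> \<Union>?\<B>" using ample_basis[OF assms(3)] assms(2) by blast
  then obtain \<D> where "\<D> \<subseteq> ?\<B>" "finite \<D>" "X \<subseteq> \<Union>\<D>"
    by (metis (no_types, lifting) assms(1) compactE compact_open_def mem_Collect_eq)
  then show ?thesis by (intro exI[of _ \<D>]) auto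
qed

lemma compact_open_bisections:
  assumes "compact_open X"
  shows "\<exists>\<X>. finite \<X> \<and> disjoint \<X> \<and> \<Union>\<X> = X \<and> (\<forall>B\<in>\<X>. compact_open B \<and> bisection G B)"
proof -
  obtain \<D> where D: "finite \<D>" "X \<subseteq> \<Union>\<D>" "\<forall>B\<in>\<D>. compact_open B \<and> bisection G B \<and> B \<subseteq> X"
    using compact_cover_bisections[of X X] assms by (auto simp: compact_open_def)
  then have "\<Union>\<D> = X" by auto
  moreover have "\<exists>\<X>. finite \<X> \<and> disjoint \<X> \<and> \<Union>\<X> = \<Union>\<D> \<and> (\<forall>B\<in>\<X>. compact_open B \<and> bisection G B)"
    by (rule finite_disjoint_refinement)
       (use D in \<open>auto intro: compact_open_Diff bisection_subset[OF _ Diff_subset]\<close>)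
  ultimately show ?thesis by simp
qed

text \<open>The tiling is run for compact open sets, whose products and boundaries are again compact
  open and thus measurable. The resulting estimate passes down to a smaller compact set by
  \<open>folner_elementary_mono\<close>.\<close>

lemma compact_subset_compact_open:
  fixes K :: "'g set" assumes "compact K" obtains K' where "compact_open K'" "K \<subseteq> K'"
proof -
  obtain \<D> where D: "finite \<D>" "K \<subseteq> \<Union>\<D>" "\<forall>B\<in>\<D>. compact_open B"
    using compact_cover_bisections[of K UNIV] assms by auto
  show ?thesis using that[of "\<Union>\<D>"] D compact_open_UN[of \<D> id] by auto
qed

text \<open>Each of the finitely many bisections meets a fibre at most once. Finiteness matters
  throughout because \<open>card\<close> is 0 on infinite sets.\<close>

lemma finite_fib:
  assumes "compact_open X" shows "finite (fib G X u)"
proof -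
  obtain \<X> where X: "finite \<X>" "\<Union>\<X> = X" "\<forall>B\<in>\<X>. bisection G B"
    using compact_open_bisections[OF assms] by auto
  have "finite (fib G B u)" if "B \<in> \<X>" for B
  proof (rule finite_imageD)
    show "finite (s ` fib G B u)" by (rule finite_subset[of _ "{u}"]) (auto simp: fib_def)
    show "inj_on s (fib G B u)" using X(3) that by (auto simp: fib_def bisection_def inj_on_def)
  qed
  moreover have "fib G X u = (\<Union>B\<in>\<X>. fib G B u)" using X(2) by (auto simp: fib_def)
  ultimately show ?thesis using X(1) by simp
qed

lemma finite_setmul:
  assumes "compact_open K" "finite P" shows "finite (setmul G K P)"
proof -
  have "setmul G K P = (\<Union>a\<in>P. (\<lambda>k. k \<odot> a) ` fib G K (r a))"
    by (auto simp: setmul_def fib_def)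
  then show ?thesis using assms finite_fib by simp
qed

text \<open>Near a product of \<open>a\<close> and \<open>b\<close> the first factor can be chosen
  continuously. On a compact open bisection \<open>A0\<close> around \<open>a\<close> the range map
  has a continuous inverse \<open>q\<close>, and an arrow \<open>c\<close> near the product factors
  as \<open>q (r c)\<close> times \<open>ginv G (q (r c)) \<odot> c\<close>. The second factor
  depends continuously on \<open>c\<close>, so it stays in \<open>B\<close>.\<close>

lemma open_setmul:
  assumes "open A" "open B" shows "open (setmul G A B)"
proof (subst open_subopen, intro ballI)
  fix c0 assume "c0 \<in> setmul G A B"
  then obtain a b where ab: "a \<in> A" "b \<in> B" "s a = r b" "c0 = a \<odot> b" by (auto simp: setmul_def)
  obtain A0 where A0: "compact_open A0" "bisection G A0" "a \<in> A0" "A0 \<subseteq> A"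
    using ample_basis[OF assms(1) ab(1)] by metis
  define q where "q = the_inv_into A0 r"
  have inj: "inj_on r A0" using A0 by (simp add: bisection_def)
  have q: "q (r x) = x" if "x \<in> A0" for x
    using inj that by (simp add: q_def the_inv_into_f_f)
  have cq: "continuous_on (r ` A0) q"
    using A0 q continuous_r by (intro continuous_on_inv) (simp_all add: compact_open_def)
  define V where "V = r -` (r ` A0)"
  have V: "open V"
    using compact_open_r[OF A0(1)] continuous_r by (simp add: V_def compact_open_def open_vimage)
  have rq: "r (q (r c)) = r c" "q (r c) \<in> A0" if "c \<in> V" for c
    using that q by (auto simp: V_def)
  have "continuous_on V (\<lambda>c. q (r c))"
    by (rule continuous_on_compose2[OF cq])
       (auto simp: V_def continuous_r)
  then have "continuous_on V (\<lambda>c. ginv G (q (r c)))"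
    by (rule continuous_on_compose2[OF continuous_ginv]) auto
  then have "continuous_on V (\<lambda>c. (ginv G (q (r c)), c))"
    by (intro continuous_intros)
  then have "continuous_on V (\<lambda>c. ginv G (q (r c)) \<odot> c)"
    by (rule continuous_on_compose2[OF continuous_mul[OF order_refl], where f = "\<lambda>c. (ginv G (q (r c)), c)", simplified fst_conv snd_conv])
       (use rq in auto)
  then have op: "open ((\<lambda>c. ginv G (q (r c)) \<odot> c) -` B \<inter> V)"
    using V assms(2) by (simp add: continuous_on_open_vimage)
  have "c0 \<in> V" using ab A0 by (auto simp: V_def)
  moreover have "ginv G (q (r c0)) \<odot> c0 = b"
    using ab A0(3) q by (simp add: ginv_mul_mul)
  moreover have "c \<in> setmul G A B" if "c \<in> V" "ginv G (q (r c)) \<odot> c \<in> B" for c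
    using that rq[OF that(1)] A0(4) mul_ginv_cancel[of "q (r c)" c]
    unfolding setmul_def by (intro CollectI exI[of _ "q (r c)"] exI[of _ "ginv G (q (r c)) \<odot> c"]) auto
  ultimately show "\<exists>T. open T \<and> c0 \<in> T \<and> T \<subseteq> setmul G A B"
    using op ab(2) by (intro exI[of _ "(\<lambda>c. ginv G (q (r c)) \<odot> c) -` B \<inter> V"]) auto
qed

lemma compact_open_setmul:
  assumes "compact_open A" "compact_open B" shows "compact_open (setmul G A B)"
proof -
  let ?Z = "{p. s (fst p) = r (snd p)}"
  have "closed ?Z"
    by (intro closed_Collect_eq continuous_on_compose2[OF continuous_s] continuous_on_compose2[OF continuous_r]
        continuous_intros) auto
  then have "compact ((A \<times> B) \<inter> ?Z)"
    using assms by (intro compact_Int_closed compact_Times) (auto simp: compact_open_def)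
  then have "compact ((\<lambda>p. fst p \<odot> snd p) ` ((A \<times> B) \<inter> ?Z))"
    by (rule compact_continuous_image[OF continuous_mul, rotated]) auto
  moreover have "(\<lambda>p. fst p \<odot> snd p) ` ((A \<times> B) \<inter> ?Z) = setmul G A B"
    by (force simp: setmul_def)
  ultimately show ?thesis using assms open_setmul by (simp add: compact_open_def)
qed

section \<open>Invariant measures\<close>

lemma inv_measure_prob: "\<mu> \<in> inv_measures G \<Longrightarrow> prob_space \<mu>"
  and inv_measure_space: "\<mu> \<in> inv_measures G \<Longrightarrow> space \<mu> = units G"
  and inv_measure_invariant: "\<mu> \<in> inv_measures G \<Longrightarrow> compact_open B \<Longrightarrow> bisection G B \<Longrightarrow>
    measure \<mu> (s ` B) = measure \<mu> (r ` B)"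
  unfolding inv_measures_def compact_open_def
  by (auto dest: sets_eq_imp_space_eq simp: space_restrict_space)

lemma inv_measure_sets:
  assumes "\<mu> \<in> inv_measures G" "compact_open X" "X \<subseteq> units G"
  shows "X \<in> sets \<mu>"
  using assms unfolding inv_measures_def compact_open_def
  by (auto simp: sets_restrict_space image_iff intro!: bexI[of _ X])

end

section \<open>Counting inequalities obtained by integrating sums of indicators\<close>

lemma (in finite_measure) measure_le_sum_of_count:
  assumes J: "finite J" and X: "\<And>j. j \<in> J \<Longrightarrow> X j \<in> sets M" and Q: "Q \<in> sets M"
    and count: "\<And>u. u \<in> Q \<Longrightarrow> a \<le> real (card {j\<in>J. u \<in> X j})"
  shows "a * measure M Q \<le> (\<Sum>j\<in>J. measure M (X j))"
proof -
  have ind: "(\<Sum>j\<in>J. indicator (X j) u) = real (card {j\<in>J. u \<in> X j})" for u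
    using J by (simp add: indicator_def of_bool_def sum.If_cases Int_def)
  have "a * measure M Q = (\<integral>u. a * indicator Q u \<partial>M)" using Q by simp
  also have "\<dots> \<le> (\<integral>u. (\<Sum>j\<in>J. indicator (X j) u) \<partial>M)"
  proof (rule integral_mono)
    show "integrable M (\<lambda>u. a * indicator Q u :: real)"
      using Q by (intro integrable_mult_right) (auto simp: less_top[symmetric])
    show "integrable M (\<lambda>u. \<Sum>j\<in>J. indicator (X j) u :: real)"
      using X by (intro Bochner_Integration.integrable_sum) (auto simp: less_top[symmetric])
    show "a * indicator Q u \<le> (\<Sum>j\<in>J. indicator (X j) u)" for u
      using count[of u] by (cases "u \<in> Q") (simp_all add: ind)
  qed
  also have "\<dots> = (\<Sum>j\<in>J. measure M (X j))"
    using X by (subst Bochner_Integration.integral_sum) (auto simp: less_top[symmetric])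
  finally show ?thesis .
qed

text \<open>For this direction the integrands must also compare outside \<open>Q\<close>, where the
  right one is 0; the inclusion \<open>sub\<close> makes the counting function vanish there.\<close>

lemma (in finite_measure) sum_measure_le_of_count:
  assumes J: "finite J" and X: "\<And>j. j \<in> J \<Longrightarrow> X j \<in> sets M" and Q: "Q \<in> sets M"
    and sub: "\<And>j. j \<in> J \<Longrightarrow> X j \<subseteq> Q"
    and count: "\<And>u. u \<in> Q \<Longrightarrow> real (card {j\<in>J. u \<in> X j}) \<le> a"
  shows "(\<Sum>j\<in>J. measure M (X j)) \<le> a * measure M Q"
proof -
  have ind: "(\<Sum>j\<in>J. indicator (X j) u) = real (card {j\<in>J. u \<in> X j})" for u
    using J by (simp add: indicator_def of_bool_def sum.If_cases Int_def)
  have "(\<Sum>j\<in>J. measure M (X j)) = (\<integral>u. (\<Sum>j\<in>J. indicator (X j) u) \<partial>M)"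
    using X by (subst Bochner_Integration.integral_sum) (auto simp: less_top[symmetric])
  also have "\<dots> \<le> (\<integral>u. a * indicator Q u \<partial>M)"
  proof (rule integral_mono)
    show "integrable M (\<lambda>u. a * indicator Q u :: real)"
      using Q by (intro integrable_mult_right) (auto simp: less_top[symmetric])
    show "integrable M (\<lambda>u. \<Sum>j\<in>J. indicator (X j) u :: real)"
      using X by (intro Bochner_Integration.integrable_sum) (auto simp: less_top[symmetric])
    show "(\<Sum>j\<in>J. indicator (X j) u) \<le> a * indicator Q u" for u
    proof (cases "u \<in> Q")
      case False
      then have "{j\<in>J. u \<in> X j} = {}" using sub by auto
      then show ?thesis using False by (simp add: ind)
    qed (use count ind in auto)
  qed
  also have "\<dots> = a * measure M Q" using Q by simp
  finally show ?thesis .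
qed

section \<open>Transport of mass from ranges to sources\<close>

context ample
begin

lemma card_fib_bisections:
  assumes "finite \<X>" "disjoint \<X>" "\<forall>B\<in>\<X>. bisection G B"
  shows "card (fib G (\<Union>\<X>) u) = card {B\<in>\<X>. u \<in> s ` B}"
proof -
  have "bij_betw (\<lambda>g. THE B. B \<in> \<X> \<and> g \<in> B) (fib G (\<Union>\<X>) u) {B\<in>\<X>. u \<in> s ` B}"
  proof (rule bij_betw_byWitness[where f' = "\<lambda>B. the_inv_into B s u"])
    have the: "(THE B. B \<in> \<X> \<and> g \<in> B) = B" if "B \<in> \<X>" "g \<in> B" for g B
      using that assms(2) unfolding disjoint_def by (intro the_equality) auto
    have inv: "the_inv_into B s (s g) = g" if "B \<in> \<X>" "g \<in> B" for g B
      using that assms(3) by (auto simp: bisection_def the_inv_into_f_f)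
    show "\<forall>g\<in>fib G (\<Union>\<X>) u. the_inv_into (THE B. B \<in> \<X> \<and> g \<in> B) s u = g"
      using the inv by (auto simp: fib_def)
    show "\<forall>B\<in>{B \<in> \<X>. u \<in> s ` B}. (THE Ba. Ba \<in> \<X> \<and> the_inv_into B s u \<in> Ba) = B"
      using the inv by auto
    show "(\<lambda>g. THE B. B \<in> \<X> \<and> g \<in> B) ` fib G (\<Union> \<X>) u \<subseteq> {B \<in> \<X>. u \<in> s ` B}"
      using the by (auto simp: fib_def)
    show "(\<lambda>B. the_inv_into B s u) ` {B \<in> \<X>. u \<in> s ` B} \<subseteq> fib G (\<Union> \<X>) u"
      using inv by (auto simp: fib_def)
  qed
  then show ?thesis by (rule bij_betw_same_card)
qed

text \<open>Invariance moves each bisection piece from its range to its source at equal measure. The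
  sources overlap with multiplicity equal to the fibre size, and overlaps of the ranges only lower
  the left side.\<close>

lemma measure_range_le:
  assumes \<mu>: "\<mu> \<in> inv_measures G" and X: "compact_open X"
    and W: "compact_open W" "W \<subseteq> units G" "s ` X \<subseteq> W"
    and count: "\<And>u. u \<in> W \<Longrightarrow> real (card (fib G X u)) \<le> c"
  shows "measure \<mu> (r ` X) \<le> c * measure \<mu> W"
proof -
  interpret prob_space \<mu> using \<mu> by (rule inv_measure_prob)
  obtain \<X> where \<X>: "finite \<X>" "disjoint \<X>" "\<Union>\<X> = X" "\<forall>B\<in>\<X>. compact_open B \<and> bisection G B"
    using compact_open_bisections[OF X] by auto
  have sets: "s ` B \<in> sets \<mu>" "r ` B \<in> sets \<mu>" if "B \<in> \<X>" for B
    using that \<X> by (auto intro!: inv_measure_sets[OF \<mu>] compact_open_s compact_open_r)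
  have "measure \<mu> (r ` X) = measure \<mu> (\<Union>B\<in>\<X>. r ` B)" using \<X>(3) by (metis image_Union)
  also have "\<dots> \<le> (\<Sum>B\<in>\<X>. measure \<mu> (r ` B))"
    using sets \<X>(1) by (intro finite_measure_subadditive_finite) auto
  also have "\<dots> = (\<Sum>B\<in>\<X>. measure \<mu> (s ` B))"
    using \<X>(4) inv_measure_invariant[OF \<mu>] by simp
  also have "\<dots> \<le> c * measure \<mu> W"
  proof (rule sum_measure_le_of_count[OF \<X>(1) sets(1)])
    show "W \<in> sets \<mu>" using inv_measure_sets[OF \<mu>] W by auto
    show "s ` B \<subseteq> W" if "B \<in> \<X>" for B using that W \<X>(3) by auto
    show "real (card {B \<in> \<X>. u \<in> s ` B}) \<le> c" if "u \<in> W" for u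
      using count[OF that] card_fib_bisections[OF \<X>(1,2), of u] \<X>(3,4) by simp
  qed
  finally show ?thesis .
qed

text \<open>The reverse transport: injectivity of \<open>r\<close> makes the ranges of the pieces
  disjoint, so their measures add up without loss.\<close>

lemma measure_range_ge:
  assumes \<mu>: "\<mu> \<in> inv_measures G" and X: "compact_open X" "inj_on r X"
    and W: "compact_open W" "W \<subseteq> units G"
    and count: "\<And>u. u \<in> W \<Longrightarrow> c \<le> real (card (fib G X u))"
  shows "c * measure \<mu> W \<le> measure \<mu> (r ` X)"
proof -
  interpret prob_space \<mu> using \<mu> by (rule inv_measure_prob)
  obtain \<X> where \<X>: "finite \<X>" "disjoint \<X>" "\<Union>\<X> = X" "\<forall>B\<in>\<X>. compact_open B \<and> bisection G B"
    using compact_open_bisections[OF X(1)] by auto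
  have sets: "s ` B \<in> sets \<mu>" "r ` B \<in> sets \<mu>" if "B \<in> \<X>" for B
    using that \<X> by (auto intro!: inv_measure_sets[OF \<mu>] compact_open_s compact_open_r)
  have "c * measure \<mu> W \<le> (\<Sum>B\<in>\<X>. measure \<mu> (s ` B))"
  proof (rule measure_le_sum_of_count[OF \<X>(1) sets(1)])
    show "W \<in> sets \<mu>" using inv_measure_sets[OF \<mu>] W by auto
    show "c \<le> real (card {B \<in> \<X>. u \<in> s ` B})" if "u \<in> W" for u
      using count[OF that] card_fib_bisections[OF \<X>(1,2), of u] \<X>(3,4) by simp
  qed
  also have "\<dots> = (\<Sum>B\<in>\<X>. measure \<mu> (r ` B))"
    using \<X>(4) inv_measure_invariant[OF \<mu>] by simp
  also have "\<dots> = measure \<mu> (\<Union>B\<in>\<X>. r ` B)"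
  proof (rule finite_measure_finite_Union[symmetric])
    show "disjoint_family_on ((`) r) \<X>"
      using \<X>(2,3) X(2) unfolding disjoint_family_on_def disjoint_def inj_on_def
      by (smt (verit) Int_emptyI Union_iff disjoint_iff imageE)
  qed (use sets \<X> in auto)
  also have "\<dots> = measure \<mu> (r ` X)" using \<X>(3) by (metis image_Union)
  finally show ?thesis .
qed

section \<open>Elementary subgroupoids\<close>

lemma multisection_mul:
  assumes "multisection G F C" "i \<in> F" "j \<in> F" "k \<in> F" "a \<in> C i j" "b \<in> C j k" "s a = r b"
  shows "a \<odot> b \<in> C i k"
  using assms unfolding multisection_def setmul_def by blast

lemma multisection_factor:
  assumes "multisection G F C" "i \<in> F" "j \<in> F" "k \<in> F" "c \<in> C i k"
  obtains a b where "a \<in> C i j" "b \<in> C j k" "s a = r b" "c = a \<odot> b"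
proof -
  have "c \<in> setmul G (C i j) (C j k)" using assms unfolding multisection_def by blast
  then show ?thesis using that by (auto simp: setmul_def)
qed

lemma multisection_level:
  assumes "multisection G F C" "i \<in> F" "u \<in> C i i" shows "u \<in> units G"
  using assms unfolding multisection_def by blast

lemma multisection_level_unique:
  assumes "multisection G F C" "i \<in> F" "j \<in> F" "u \<in> C i i" "u \<in> C j j" shows "i = j"
  using assms unfolding multisection_def disjoint_family_on_def by blast

lemma multisection_bisection:
  assumes "multisection G F C" "i \<in> F" "j \<in> F" "a \<in> C i j" "b \<in> C i j" "s a = s b \<or> r a = r b"
  shows "a = b"
  using assms unfolding multisection_def bisection_def inj_on_def by blast

text \<open>The axioms speak only of products of sets, so the source is read off from a
  factorisation: when the last factor lies in the level \<open>C j j\<close>, it is a unit and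
  therefore equals the source.\<close>

lemma multisection_s:
  assumes ms: "multisection G F C" and "i \<in> F" "j \<in> F" "c \<in> C i j" shows "s c \<in> C j j"
proof -
  obtain a b where ab: "a \<in> C i j" "b \<in> C j j" "s a = r b" "c = a \<odot> b"
    using multisection_factor[OF ms assms(2,3,3,4)] .
  then have "s c = b" using s_unit multisection_level[OF ms assms(3)] by simp
  then show ?thesis using ab by simp
qed

lemma multisection_r:
  assumes ms: "multisection G F C" and "i \<in> F" "j \<in> F" "c \<in> C i j" shows "r c \<in> C i i"
proof -
  obtain a b where ab: "a \<in> C i i" "b \<in> C i j" "s a = r b" "c = a \<odot> b"
    using multisection_factor[OF ms assms(2,2,3,4)] .
  then have "r c = a" using r_unit multisection_level[OF ms assms(2)] by simp
  then show ?thesis using ab by simp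
qed

lemma multisection_ex_s:
  assumes ms: "multisection G F C" and "i \<in> F" "j \<in> F" "v \<in> C j j"
  obtains c where "c \<in> C i j" "s c = v"
proof -
  obtain a b where ab: "a \<in> C j i" "b \<in> C i j" "s a = r b" "v = a \<odot> b"
    using multisection_factor[OF ms assms(3,2,3,4)] .
  then have "s b = v" using s_unit multisection_level[OF ms assms(3,4)] by (metis s_mul)
  then show ?thesis using that ab by blast
qed

text \<open>Factor the unit \<open>s c\<close> through \<open>C j i\<close> and
  \<open>C i j\<close>. The second factor has the same source as \<open>c\<close> and lies in the
  same bisection, so it is \<open>c\<close>, and the first factor is its inverse.\<close>

lemma multisection_ginv:
  assumes ms: "multisection G F C" and "i \<in> F" "j \<in> F" "c \<in> C i j" shows "ginv G c \<in> C j i"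
proof -
  have "s c \<in> C j j" using multisection_s assms by blast
  then obtain a b where ab: "a \<in> C j i" "b \<in> C i j" "s a = r b" "s c = a \<odot> b"
    using multisection_factor[OF ms assms(3,2,3)] by blast
  have "s b = s c" using ab(3,4) by (metis s_mul s_s)
  then have "b = c" using multisection_bisection[OF ms assms(2,3)] ab assms by blast
  then show ?thesis using ab ginv_unique by metis
qed

lemma multisection_ex_r:
  assumes ms: "multisection G F C" and "i \<in> F" "j \<in> F" "v \<in> C i i"
  obtains c where "c \<in> C i j" "r c = v"
proof -
  obtain c where c: "c \<in> C j i" "s c = v" using multisection_ex_s[OF ms assms(3,2,4)] .
  show ?thesis using that[of "ginv G c"] multisection_ginv[OF ms assms(3,2) c(1)] c by simp
qed

text \<open>Selecting indices \<open>E\<close> and a base \<open>W\<close> inside the level of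
  \<open>i0\<close> again gives a multisection: \<open>W\<close> is carried to the level of
  \<open>j\<close> by \<open>C j i0\<close>, and an arrow survives when its source lies in the
  transported copy.\<close>

lemma multisection_restrict:
  assumes ms: "multisection G F C" and i0: "i0 \<in> F" and E: "E \<subseteq> F"
  shows "multisection G E (\<lambda>i j. C i j \<inter> s -` r ` (C j i0 \<inter> s -` W))"
  unfolding multisection_def
proof (intro conjI ballI)
  show "finite E" using ms E finite_subset by (auto simp: multisection_def)
  fix i assume i: "i \<in> E"
  show "C i i \<inter> s -` r ` (C i i0 \<inter> s -` W) \<subseteq> units G"
    using multisection_level[OF ms] i E by blast
  fix j assume j: "j \<in> E"
  show "bisection G (C i j \<inter> s -` r ` (C j i0 \<inter> s -` W))"
    using ms i j E bisection_subset[OF _ Int_lower1] unfolding multisection_def by blast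
  fix k assume k: "k \<in> E"
  have F: "i \<in> F" "j \<in> F" "k \<in> F" using i j k E by auto
  show "setmul G (C i j \<inter> s -` r ` (C j i0 \<inter> s -` W)) (C j k \<inter> s -` r ` (C k i0 \<inter> s -` W)) =
      C i k \<inter> s -` r ` (C k i0 \<inter> s -` W)" (is "setmul G ?A ?B = ?R")
  proof
    show "setmul G ?A ?B \<subseteq> ?R"
      using multisection_mul[OF ms F] by (auto simp: setmul_def)
    show "?R \<subseteq> setmul G ?A ?B"
    proof
      fix c assume "c \<in> ?R"
      then obtain d where c: "c \<in> C i k" "s c = r d" "d \<in> C k i0" "s d \<in> W" by auto
      obtain a b where ab: "a \<in> C i j" "b \<in> C j k" "s a = r b" "c = a \<odot> b"
        using multisection_factor[OF ms F c(1)] .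
      \<comment> \<open>The arrow \<open>b \<odot> d\<close> runs from the point \<open>s d\<close>
        of \<open>W\<close> to the source of \<open>a\<close>, which puts \<open>a\<close> into the
        restricted set.\<close>
      have sb: "s b = r d" using ab c by simp
      then have "b \<odot> d \<in> C j i0" "s (b \<odot> d) \<in> W" "r (b \<odot> d) = s a"
        using multisection_mul[OF ms F(2,3) i0 ab(2) c(3)] c ab by auto
      then have "a \<in> ?A" using ab by (auto intro!: rev_image_eqI[of "b \<odot> d"])
      moreover have "b \<in> ?B" using ab c sb by auto
      ultimately show "c \<in> setmul G ?A ?B" using ab unfolding setmul_def by blast
    qed
  qed
next
  show "disjoint_family_on (\<lambda>i. C i i \<inter> s -` r ` (C i i0 \<inter> s -` W)) E"
    using ms E unfolding multisection_def disjoint_family_on_def by blast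
qed

section \<open>Elementary subgroupoids and their disjoint unions\<close>

lemma elementary_multisection:
  assumes "co_multisection G E D"
  shows "elementary_subgroupoid G (\<Union>i\<in>E. \<Union>j\<in>E. D i j)"
proof -
  have ms: "multisection G E D" and co: "\<And>i j. i \<in> E \<Longrightarrow> j \<in> E \<Longrightarrow> compact_open (D i j)"
    using assms by (auto simp: co_multisection_def compact_open_def)
  let ?H = "\<Union>i\<in>E. \<Union>j\<in>E. D i j"
  have fin: "finite E" using ms by (simp add: multisection_def)
  have "compact_open ?H" using fin co by (intro compact_open_UN) auto
  moreover have "a \<odot> b \<in> ?H" if ab: "a \<in> ?H" "b \<in> ?H" "s a = r b" for a b
  proof -
    obtain i j i' k where ij: "i \<in> E" "j \<in> E" "i' \<in> E" "k \<in> E" "a \<in> D i j" "b \<in> D i' k"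
      using ab(1,2) by blast
    have "j = i'"
      using multisection_level_unique[OF ms ij(2,3)] multisection_s[OF ms ij(1,2,5)]
        multisection_r[OF ms ij(3,4,6)] ab(3) by simp
    then have "a \<odot> b \<in> D i k" using multisection_mul[OF ms ij(1,2,4,5)] ij(6) ab(3) by simp
    then show ?thesis using ij by blast
  qed
  moreover have "ginv G a \<in> ?H" if "a \<in> ?H" for a
    using that multisection_ginv[OF ms] by blast
  moreover have "\<exists>(I :: nat set) F C. finite I \<and> (\<forall>l\<in>I. co_multisection G (F l) (C l)) \<and>
        (\<forall>l\<in>I. \<forall>l'\<in>I. l \<noteq> l' \<longrightarrow>
           (\<forall>i\<in>F l. \<forall>j\<in>F l. \<forall>i'\<in>F l'. \<forall>j'\<in>F l'. setmul G (C l i j) (C l' i' j') = {})) \<and>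
        ?H = (\<Union>l\<in>I. \<Union>i\<in>F l. \<Union>j\<in>F l. C l i j)"
    by (rule exI[of _ "{0}"], rule exI[of _ "\<lambda>_. E"], rule exI[of _ "\<lambda>_. D"]) (use assms in simp)
  ultimately show ?thesis unfolding elementary_subgroupoid_def compact_open_def by simp
qed

lemma elementary_empty: "elementary_subgroupoid G {}"
  using elementary_multisection[of "{}"]
  by (simp add: co_multisection_def multisection_def disjoint_family_on_def)

lemma elementary_mul:
  "elementary_subgroupoid G H \<Longrightarrow> a \<in> H \<Longrightarrow> b \<in> H \<Longrightarrow> s a = r b \<Longrightarrow> a \<odot> b \<in> H"
  and elementary_ginv: "elementary_subgroupoid G H \<Longrightarrow> a \<in> H \<Longrightarrow> ginv G a \<in> H"
  and elementary_compact_open: "elementary_subgroupoid G H \<Longrightarrow> compact_open H"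
  unfolding elementary_subgroupoid_def compact_open_def by simp_all

lemma elementary_s:
  assumes "elementary_subgroupoid G H" "a \<in> H" shows "s a \<in> unit_space_of G H"
proof -
  have "ginv G a \<odot> a \<in> H" by (rule elementary_mul[OF assms(1) elementary_ginv[OF assms] assms(2)]) simp
  then show ?thesis by (simp add: unit_space_of_def)
qed

lemma elementary_r:
  assumes "elementary_subgroupoid G H" "a \<in> H" shows "r a \<in> unit_space_of G H"
  using elementary_s[OF assms(1), of "ginv G a"] elementary_ginv[OF assms] by simp

text \<open>Sources and ranges of arrows stay in the unit space of their own subgroupoid. Disjoint
  unit spaces therefore exclude composable pairs across the two parts, so closure and the castle
  condition can be checked separately.\<close>

lemma elementary_Un:
  assumes H1: "elementary_subgroupoid G H1" and H2: "elementary_subgroupoid G H2"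
    and disj: "unit_space_of G H1 \<inter> unit_space_of G H2 = {}"
  shows "elementary_subgroupoid G (H1 \<union> H2)"
proof -
  have no: "s a \<noteq> r b" if "a \<in> H1 \<and> b \<in> H2 \<or> a \<in> H2 \<and> b \<in> H1" for a b
    using that disj elementary_s[OF H1] elementary_s[OF H2] elementary_r[OF H1] elementary_r[OF H2]
    by fastforce
  obtain I1 :: "nat set" and F1 C1 where E1: "finite I1" "\<forall>l\<in>I1. co_multisection G (F1 l) (C1 l)"
    "\<forall>l\<in>I1. \<forall>l'\<in>I1. l \<noteq> l' \<longrightarrow> (\<forall>i\<in>F1 l. \<forall>j\<in>F1 l. \<forall>i'\<in>F1 l'. \<forall>j'\<in>F1 l'. setmul G (C1 l i j) (C1 l' i' j') = {})"
    "H1 = (\<Union>l\<in>I1. \<Union>i\<in>F1 l. \<Union>j\<in>F1 l. C1 l i j)"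
    using H1 unfolding elementary_subgroupoid_def by (elim conjE exE) (rule that)
  obtain I2 :: "nat set" and F2 C2 where E2: "finite I2" "\<forall>l\<in>I2. co_multisection G (F2 l) (C2 l)"
    "\<forall>l\<in>I2. \<forall>l'\<in>I2. l \<noteq> l' \<longrightarrow> (\<forall>i\<in>F2 l. \<forall>j\<in>F2 l. \<forall>i'\<in>F2 l'. \<forall>j'\<in>F2 l'. setmul G (C2 l i j) (C2 l' i' j') = {})"
    "H2 = (\<Union>l\<in>I2. \<Union>i\<in>F2 l. \<Union>j\<in>F2 l. C2 l i j)"
    using H2 unfolding elementary_subgroupoid_def by (elim conjE exE) (rule that)
  \<comment> \<open>Even indices carry the first castle and odd indices the second, which keeps the
    two index sets apart.\<close>
  define I where "I = (\<lambda>l. 2 * l) ` I1 \<union> (\<lambda>l. 2 * l + 1) ` I2"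
  define F where "F l = (if even l then F1 (l div 2) else F2 (l div 2))" for l
  define C where "C l = (if even l then C1 (l div 2) else C2 (l div 2))" for l
  have I: "finite I" using E1(1) E2(1) by (simp add: I_def)
  have cms: "\<forall>l\<in>I. co_multisection G (F l) (C l)"
    using E1(2) E2(2) by (auto simp: I_def F_def C_def)
  have un: "H1 \<union> H2 = (\<Union>l\<in>I. \<Union>i\<in>F l. \<Union>j\<in>F l. C l i j)"
    unfolding E1(4) E2(4) I_def F_def C_def by (simp add: UN_Un)
  have castle: "setmul G (C l i j) (C l' i' j') = {}"
    if l: "l \<in> I" "l' \<in> I" "l \<noteq> l'" "i \<in> F l" "j \<in> F l" "i' \<in> F l'" "j' \<in> F l'" for l l' i j i' j'
  proof -
    have sub1: "C1 k i j \<subseteq> H1" if "k \<in> I1" "i \<in> F1 k" "j \<in> F1 k" for k i j using that E1(4) by blast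
    have sub2: "C2 k i j \<subseteq> H2" if "k \<in> I2" "i \<in> F2 k" "j \<in> F2 k" for k i j using that E2(4) by blast
    have emp: "setmul G A B = {}" if "A \<subseteq> H1 \<and> B \<subseteq> H2 \<or> A \<subseteq> H2 \<and> B \<subseteq> H1" for A B
      using that no unfolding setmul_def by blast
    consider k k' where "k \<in> I1" "k' \<in> I1" "l = 2 * k" "l' = 2 * k'"
      | k k' where "k \<in> I1" "k' \<in> I2" "l = 2 * k" "l' = 2 * k' + 1"
      | k k' where "k \<in> I2" "k' \<in> I1" "l = 2 * k + 1" "l' = 2 * k'"
      | k k' where "k \<in> I2" "k' \<in> I2" "l = 2 * k + 1" "l' = 2 * k' + 1"
      using l(1,2) unfolding I_def by blast
    then show ?thesis
    proof cases
      case 1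
      then show ?thesis using l E1(3) by (simp add: F_def C_def)
    next
      case 2
      then show ?thesis using l emp sub1 sub2 by (simp add: F_def C_def)
    next
      case 3
      then show ?thesis using l emp sub1 sub2 by (simp add: F_def C_def)
    next
      case 4
      then show ?thesis using l E2(3) by (simp add: F_def C_def)
    qed
  qed
  have "\<exists>(I :: nat set) F C. finite I \<and> (\<forall>l\<in>I. co_multisection G (F l) (C l)) \<and>
        (\<forall>l\<in>I. \<forall>l'\<in>I. l \<noteq> l' \<longrightarrow>
           (\<forall>i\<in>F l. \<forall>j\<in>F l. \<forall>i'\<in>F l'. \<forall>j'\<in>F l'. setmul G (C l i j) (C l' i' j') = {})) \<and>
        H1 \<union> H2 = (\<Union>l\<in>I. \<Union>i\<in>F l. \<Union>j\<in>F l. C l i j)"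
    using I cms castle un by (intro exI[of _ I] exI[of _ F] exI[of _ C] conjI) simp_all
  moreover have "a \<odot> b \<in> H1 \<union> H2" if "a \<in> H1 \<union> H2" "b \<in> H1 \<union> H2" "s a = r b" for a b
    using that no[of a b] elementary_mul[OF H1, of a b] elementary_mul[OF H2, of a b] by blast
  moreover have "ginv G a \<in> H1 \<union> H2" if "a \<in> H1 \<union> H2" for a
    using that elementary_ginv[OF H1] elementary_ginv[OF H2] by blast
  moreover have "compact (H1 \<union> H2)" "open (H1 \<union> H2)"
    using elementary_compact_open[OF H1] elementary_compact_open[OF H2]
    by (simp_all add: compact_open_def compact_Un open_Un)
  ultimately show ?thesis unfolding elementary_subgroupoid_def by (intro conjI ballI impI) simp_all
qed

text \<open>The inequality is non-strict because trimming delivers it in this form. Strictness is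
  recovered at the end from \<open>4 * \<alpha> < \<delta>\<close> and nonempty fibres.\<close>

definition folner_elementary :: "'g set \<Rightarrow> real \<Rightarrow> 'g set \<Rightarrow> bool" where
  "folner_elementary K e H \<longleftrightarrow> elementary_subgroupoid G H \<and>
     (\<forall>u\<in>unit_space_of G H.
        real (card (setmul G K (fib G H u) - fib G H u)) \<le> e * real (card (fib G H u)))"

lemma unit_space_of_Un: "unit_space_of G (H1 \<union> H2) = unit_space_of G H1 \<union> unit_space_of G H2"
  by (auto simp: unit_space_of_def)

lemma folner_elementary_empty: "folner_elementary K e {}"
  by (simp add: folner_elementary_def elementary_empty unit_space_of_def)

text \<open>Over each unit the fibre of the union is the fibre of a single part, so the constant
  \<open>e\<close> does not deteriorate however many pieces are joined.\<close>

lemma folner_elementary_Un: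
  assumes H1: "folner_elementary K e H1" and H2: "folner_elementary K e H2"
    and disj: "unit_space_of G H1 \<inter> unit_space_of G H2 = {}"
  shows "folner_elementary K e (H1 \<union> H2)"
proof -
  have el: "elementary_subgroupoid G H1" "elementary_subgroupoid G H2"
    using H1 H2 by (auto simp: folner_elementary_def)
  have "fib G (H1 \<union> H2) u = fib G H1 u" if "u \<in> unit_space_of G H1" for u
    using that disj elementary_s[OF el(2)] by (auto simp: fib_def)
  moreover have "fib G (H1 \<union> H2) u = fib G H2 u" if "u \<in> unit_space_of G H2" for u
    using that disj elementary_s[OF el(1)] by (auto simp: fib_def)
  ultimately show ?thesis
    using H1 H2 elementary_Un[OF el disj] unfolding folner_elementary_def unit_space_of_Un by auto
qed

lemma folner_elementary_UN:
  assumes "finite I" and "\<And>i. i \<in> I \<Longrightarrow> folner_elementary K e (H i)"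
    and "disjoint_family_on (\<lambda>i. unit_space_of G (H i)) I"
  shows "folner_elementary K e (\<Union>i\<in>I. H i)"
  using assms
proof (induction I)
  case empty
  then show ?case by (simp add: folner_elementary_empty)
next
  case (insert i I)
  have d: "disjoint_family_on (\<lambda>i. unit_space_of G (H i)) I"
    using insert.prems(2) by (rule disjoint_family_on_mono[rotated]) auto
  have "folner_elementary K e (\<Union>i\<in>I. H i)"
    by (rule insert.IH[OF insert.prems(1) d]) simp
  moreover have "unit_space_of G (H i) \<inter> unit_space_of G (\<Union>i\<in>I. H i) = {}"
  proof -
    have "unit_space_of G (H i) \<inter> unit_space_of G (H j) = {}" if "j \<in> I" for j
      using disjoint_family_onD[OF insert.prems(2), of i j] insert.hyps(2) that by auto
    then show ?thesis unfolding unit_space_of_def by fast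
  qed
  ultimately have "folner_elementary K e (H i \<union> (\<Union>i\<in>I. H i))"
    by (intro folner_elementary_Un insert.prems(1)) simp_all
  then show ?case by simp
qed

text \<open>For a multisection with \<open>i0\<close> and \<open>E\<close> among its indices, this
  is the set of all products \<open>a \<odot> ginv G b\<close> where \<open>a\<close> and
  \<open>b\<close> have a common source in \<open>W\<close> and lie in sets \<open>C i i0\<close>
  with \<open>i\<close> in \<open>E\<close>. It is the equivalence relation whose classes are the
  tiles over \<open>W\<close>, reduced to the levels in \<open>E\<close>.\<close>

definition tower :: "(nat \<Rightarrow> nat \<Rightarrow> 'g set) \<Rightarrow> nat set \<Rightarrow> nat \<Rightarrow> 'g set \<Rightarrow> 'g set" where
  "tower C E i0 W = (\<Union>i\<in>E. \<Union>j\<in>E. C i j \<inter> s -` r ` (C j i0 \<inter> s -` W))"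

lemma elementary_tower:
  assumes ms: "co_multisection G F C" and i0: "i0 \<in> F" and E: "E \<subseteq> F" and W: "compact_open W"
  shows "elementary_subgroupoid G (tower C E i0 W)"
  unfolding tower_def
proof (rule elementary_multisection)
  have "compact_open (C i j \<inter> s -` r ` (C j i0 \<inter> s -` W))" if "i \<in> E" "j \<in> E" for i j
  proof -
    have "compact_open (C i j)" "compact_open (C j i0)"
      using that ms i0 E by (auto simp: co_multisection_def compact_open_def)
    then show ?thesis using W by (intro compact_open_s_vimage compact_open_r)
  qed
  then show "co_multisection G E (\<lambda>i j. C i j \<inter> s -` r ` (C j i0 \<inter> s -` W))"
    using multisection_restrict[OF _ i0 E] ms by (simp add: co_multisection_def compact_open_def)
qed

lemma unit_space_tower:
  assumes ms: "multisection G F C" and i0: "i0 \<in> F" and E: "E \<subseteq> F"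
  shows "unit_space_of G (tower C E i0 W) = r ` ((\<Union>i\<in>E. C i i0) \<inter> s -` W)"
proof
  show "unit_space_of G (tower C E i0 W) \<subseteq> r ` ((\<Union>i\<in>E. C i i0) \<inter> s -` W)"
  proof
    fix u assume "u \<in> unit_space_of G (tower C E i0 W)"
    then have u: "u \<in> units G" "u \<in> tower C E i0 W" by (auto simp: unit_space_of_def)
    then show "u \<in> r ` ((\<Union>i\<in>E. C i i0) \<inter> s -` W)"
      using s_unit[OF u(1)] by (auto simp: tower_def)
  qed
  show "r ` ((\<Union>i\<in>E. C i i0) \<inter> s -` W) \<subseteq> unit_space_of G (tower C E i0 W)"
  proof
    fix u assume "u \<in> r ` ((\<Union>i\<in>E. C i i0) \<inter> s -` W)"
    then obtain g i where g: "i \<in> E" "g \<in> C i i0" "s g \<in> W" "u = r g" by auto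
    then have "u \<in> C i i" using multisection_r[OF ms _ i0] E by blast
    then have "u \<in> C i i \<inter> s -` r ` (C i i0 \<inter> s -` W)" using g by auto
    then show "u \<in> unit_space_of G (tower C E i0 W)"
      using g unfolding tower_def unit_space_of_def by auto
  qed
qed

lemma fib_tower:
  assumes ms: "multisection G F C" and i0: "i0 \<in> F" and E: "E \<subseteq> F"
    and g: "j \<in> E" "g \<in> C j i0" "s g \<in> W"
  shows "fib G (tower C E i0 W) (r g) = (\<lambda>a. a \<odot> ginv G g) ` fib G (\<Union>i\<in>E. C i i0) (s g)"
proof
  have jF: "j \<in> F" using g E by auto
  show "fib G (tower C E i0 W) (r g) \<subseteq> (\<lambda>a. a \<odot> ginv G g) ` fib G (\<Union>i\<in>E. C i i0) (s g)"
  proof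
    fix c assume "c \<in> fib G (tower C E i0 W) (r g)"
    then obtain i k where c: "i \<in> E" "k \<in> E" "c \<in> C i k" "s c = r g"
      by (auto simp: fib_def tower_def)
    have F: "i \<in> F" "k \<in> F" using c E by auto
    have "s c \<in> C k k" "r g \<in> C j j"
      using multisection_s[OF ms F c(3)] multisection_r[OF ms jF i0 g(2)] by auto
    then have "k = j" using multisection_level_unique[OF ms F(2) jF, of "r g"] c(4) by simp
    then have "c \<odot> g \<in> C i i0" using multisection_mul[OF ms F(1) jF i0 _ g(2) c(4)] c(3) by simp
    then have "c \<odot> g \<in> fib G (\<Union>i\<in>E. C i i0) (s g)" using c by (auto simp: fib_def)
    moreover have "c = (c \<odot> g) \<odot> ginv G g" using mul_mul_ginv[OF c(4)] by simp
    ultimately show "c \<in> (\<lambda>a. a \<odot> ginv G g) ` fib G (\<Union>i\<in>E. C i i0) (s g)" by blast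
  qed
  show "(\<lambda>a. a \<odot> ginv G g) ` fib G (\<Union>i\<in>E. C i i0) (s g) \<subseteq> fib G (tower C E i0 W) (r g)"
  proof
    fix c assume "c \<in> (\<lambda>a. a \<odot> ginv G g) ` fib G (\<Union>i\<in>E. C i i0) (s g)"
    then obtain a i where a: "i \<in> E" "a \<in> C i i0" "s a = s g" "c = a \<odot> ginv G g"
      by (auto simp: fib_def)
    have iF: "i \<in> F" using a E by auto
    have "c \<in> C i j"
      using multisection_mul[OF ms iF i0 jF a(2) multisection_ginv[OF ms jF i0 g(2)]] a by simp
    moreover have "s c = r g" using a by simp
    ultimately show "c \<in> fib G (tower C E i0 W) (r g)"
      using a(1) g unfolding fib_def tower_def by auto
  qed
qed

text \<open>Every fibre of the tower is a right translate of a tile over the base. Right translation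
  is injective and commutes with left multiplication by \<open>K\<close>, so it suffices to test the
  tiles.\<close>

lemma folner_elementary_tower:
  assumes ms: "co_multisection G F C" and i0: "i0 \<in> F" and E: "E \<subseteq> F" and W: "compact_open W"
    and K: "compact_open K"
    and folner: "\<And>w. w \<in> W \<Longrightarrow> real (card (setmul G K (fib G (\<Union>i\<in>E. C i i0) w) - fib G (\<Union>i\<in>E. C i i0) w))
      \<le> e * real (card (fib G (\<Union>i\<in>E. C i i0) w))"
  shows "folner_elementary K e (tower C E i0 W)"
  unfolding folner_elementary_def
proof (intro conjI ballI)
  show "elementary_subgroupoid G (tower C E i0 W)" by (rule elementary_tower[OF ms i0 E W])
  have ms': "multisection G F C" using ms by (simp add: co_multisection_def)
  have fin: "finite E" using E ms' finite_subset by (auto simp: multisection_def)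
  fix u assume "u \<in> unit_space_of G (tower C E i0 W)"
  then obtain g j where g: "j \<in> E" "g \<in> C j i0" "s g \<in> W" "u = r g"
    unfolding unit_space_tower[OF ms' i0 E] by auto
  define P where "P = fib G (\<Union>i\<in>E. C i i0) (s g)"
  define t where "t a = a \<odot> ginv G g" for a
  have H: "fib G (tower C E i0 W) u = t ` P"
    using fib_tower[OF ms' i0 E g(1-3)] g(4) by (simp add: P_def t_def)
  have sP: "s a = s g" if "a \<in> P" for a using that by (simp add: P_def fib_def)
  have "inj_on t P"
    by (rule inj_on_inverseI[where g = "\<lambda>c. c \<odot> g"]) (simp add: t_def mul_ginv_mul sP)
  then have card: "card (t ` P) = card P" by (rule card_image)
  have "compact_open (\<Union>i\<in>E. C i i0)"
    using fin E ms i0 by (intro compact_open_UN) (auto simp: co_multisection_def compact_open_def)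
  then have "finite P" unfolding P_def by (rule finite_fib)
  then have finK: "finite (setmul G K P - P)" using finite_setmul[OF K] by simp
  have "setmul G K (t ` P) - t ` P \<subseteq> t ` (setmul G K P - P)"
  proof
    fix c assume "c \<in> setmul G K (t ` P) - t ` P"
    then obtain k a where ka: "k \<in> K" "a \<in> P" "s k = r (t a)" "c = k \<odot> t a" "c \<notin> t ` P"
      by (auto simp: setmul_def)
    have "s k = r a" using ka sP by (simp add: t_def)
    then have "k \<odot> a \<in> setmul G K P" "c = t (k \<odot> a)"
      using ka sP mul_assoc[of k a "ginv G g"] by (auto simp: setmul_def t_def)
    then show "c \<in> t ` (setmul G K P - P)" using ka(5) by blast
  qed
  then have "card (setmul G K (t ` P) - t ` P) \<le> card (setmul G K P - P)"
    by (rule surj_card_le[OF finK])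
  then show "real (card (setmul G K (fib G (tower C E i0 W) u) - fib G (tower C E i0 W) u))
      \<le> e * real (card (fib G (tower C E i0 W) u))"
    using folner[OF g(3)] unfolding H card P_def[symmetric] by simp
qed

section \<open>Columns of a multisection and their trimming\<close>

lemma inj_on_r_column:
  assumes ms: "multisection G F C" and i0: "i0 \<in> F"
  shows "inj_on r (\<Union>i\<in>F. C i i0)"
proof (rule inj_onI)
  fix a b assume "a \<in> (\<Union>i\<in>F. C i i0)" "b \<in> (\<Union>i\<in>F. C i i0)" and eq: "r a = r b"
  then obtain i j where ij: "i \<in> F" "j \<in> F" "a \<in> C i i0" "b \<in> C j i0" by auto
  have "i = j"
    using multisection_level_unique[OF ms ij(1,2)] multisection_r[OF ms ij(1) i0 ij(3)]
      multisection_r[OF ms ij(2) i0 ij(4)] eq by simp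
  then show "a = b" using multisection_bisection[OF ms ij(1) i0 ij(3)] ij eq by simp
qed

lemma card_fib_column:
  assumes ms: "multisection G F C" and i0: "i0 \<in> F" and E: "E \<subseteq> F" and w: "w \<in> C i0 i0"
  shows "card (fib G (\<Union>i\<in>E. C i i0) w) = card E" "finite (fib G (\<Union>i\<in>E. C i i0) w)"
proof -
  have fin: "finite E" using E ms finite_subset by (auto simp: multisection_def)
  have un: "fib G (\<Union>i\<in>E. C i i0) w = (\<Union>i\<in>E. fib G (C i i0) w)" by (auto simp: fib_def)
  have single: "\<exists>g. fib G (C i i0) w = {g}" if "i \<in> E" for i
  proof -
    have iF: "i \<in> F" using that E by auto
    obtain g where g: "g \<in> C i i0" "s g = w" using multisection_ex_s[OF ms iF i0 w] .
    then have "fib G (C i i0) w = {g}"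
      using multisection_bisection[OF ms iF i0 _ g(1)] by (auto simp: fib_def)
    then show ?thesis by blast
  qed
  have disj: "fib G (C i i0) w \<inter> fib G (C j i0) w = {}" if "i \<in> E" "j \<in> E" "i \<noteq> j" for i j
  proof -
    have F: "i \<in> F" "j \<in> F" using that E by auto
    have "False" if "a \<in> C i i0" "a \<in> C j i0" for a
      using multisection_level_unique[OF ms F] multisection_r[OF ms F(1) i0 that(1)]
        multisection_r[OF ms F(2) i0 that(2)] \<open>i \<noteq> j\<close> by simp
    then show ?thesis by (auto simp: fib_def)
  qed
  have c1: "card (fib G (C i i0) w) = 1" and f1: "finite (fib G (C i i0) w)" if "i \<in> E" for i
    using single[OF that] by auto
  show "finite (fib G (\<Union>i\<in>E. C i i0) w)" unfolding un using fin f1 by simp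
  show "card (fib G (\<Union>i\<in>E. C i i0) w) = card E"
    unfolding un using fin f1 c1 disj by (subst card_UN_disjoint) auto
qed

text \<open>The towers of one multisection are trimmed to the levels outside \<open>A\<close>; which levels survive
depends on the base point, so the base is cut along the finitely many patterns \<open>E\<close> of surviving
levels, and a pattern is kept when it contains at least a proportion \<open>1 - \<alpha>\<close> of the levels.\<close>

lemma trimmed_towers:
  assumes ms: "co_multisection G F C" and i0: "i0 \<in> F"
    and A: "compact_open A" and K: "compact_open K"
    and \<alpha>: "0 < \<alpha>" "\<alpha> \<le> 1 / 2" "\<delta> \<le> \<alpha>"
    and folner: "\<And>w. w \<in> C i0 i0 \<Longrightarrow>
      real (card (setmul G K (fib G (\<Union>i\<in>F. C i i0) w) - fib G (\<Union>i\<in>F. C i i0) w)) \<le> \<delta> * real (card F)"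
  obtains T W where "folner_elementary K (4 * \<alpha>) T" "compact_open W" "W \<subseteq> C i0 i0"
    "unit_space_of G T = r ` ((\<Union>i\<in>F. C i i0) \<inter> s -` W) - A"
    "\<And>w. w \<in> C i0 i0 - W \<Longrightarrow> \<alpha> * real (card F) \<le> real (card {a \<in> fib G (\<Union>i\<in>F. C i i0) w. r a \<in> A})"
    "\<And>\<mu>. \<mu> \<in> inv_measures G \<Longrightarrow> (1 - \<alpha>) * real (card F) * measure \<mu> W \<le> measure \<mu> (unit_space_of G T)"
proof -
  have co: "compact_open (C i i0)" if "i \<in> F" for i
    using ms i0 that by (auto simp: co_multisection_def compact_open_def)
  have finF: "finite F" and m0: "multisection G F C" using ms by (auto simp: co_multisection_def multisection_def)
  define X where "X = (\<Union>i\<in>F. C i i0)"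
  have X: "compact_open X" unfolding X_def by (rule compact_open_UN[OF finF co])
  \<comment> \<open>These are the base points whose \<open>i\<close>-th tile point lies outside
    \<open>A\<close>. They form a compact open set, hence so does each cell \<open>B E\<close> of
    base points with pattern \<open>E\<close>.\<close>
  define Z where "Z i = s ` (C i i0 - r -` A)" for i
  have Zco: "compact_open (Z i)" if "i \<in> F" for i
  proof -
    have "C i i0 - r -` A = C i i0 - (C i i0 \<inter> r -` A)" by auto
    then show ?thesis unfolding Z_def using co[OF that] A
      by (auto intro!: compact_open_s compact_open_Diff compact_open_r_vimage)
  qed
  define pat where "pat w = {i\<in>F. w \<in> Z i}" for w
  define B where "B E = {w \<in> C i0 i0. pat w = E}" for E
  have Bco: "compact_open (B E)" if "E \<subseteq> F" for E
  proof -
    have "B E = (C i0 i0 \<inter> (\<Inter>i\<in>E. Z i)) - (\<Union>i\<in>F-E. Z i)"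
      using that by (auto simp: B_def pat_def)
    moreover have "compact_open \<dots>"
      using that finF co[OF i0] Zco finite_subset[OF that finF]
      by (intro compact_open_Diff compact_open_INT_Int compact_open_UN) auto
    ultimately show ?thesis by simp
  qed
  define \<E> where "\<E> = {E. E \<subseteq> F \<and> (1 - \<alpha>) * real (card F) \<le> real (card E)}"
  have finE: "finite \<E>" using finF by (simp add: \<E>_def)
  define W where "W = (\<Union>E\<in>\<E>. B E)"
  define T where "T = (\<Union>E\<in>\<E>. tower C E i0 (B E))"
  have Wiff: "w \<in> W \<longleftrightarrow> w \<in> C i0 i0 \<and> (1 - \<alpha>) * real (card F) \<le> real (card (pat w))" for w
    by (auto simp: W_def B_def \<E>_def pat_def)
  have Wco: "compact_open W" unfolding W_def using finE Bco by (intro compact_open_UN) (auto simp: \<E>_def)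
  have r_pat: "r g \<notin> A \<longleftrightarrow> i \<in> pat (s g)" if "g \<in> C i i0" "i \<in> F" for g i
  proof
    assume "i \<in> pat (s g)"
    then obtain g' where g': "g' \<in> C i i0" "r g' \<notin> A" "s g' = s g" by (auto simp: pat_def Z_def)
    then have "g' = g" using multisection_bisection[OF m0 that(2) i0 g'(1) that(1)] by simp
    then show "r g \<notin> A" using g' by simp
  qed (use that in \<open>auto simp: pat_def Z_def\<close>)
  have fib_pat: "fib G (\<Union>i\<in>pat w. C i i0) w = {a \<in> fib G X w. r a \<notin> A}" for w
    using r_pat by (auto simp: fib_def X_def pat_def)
  have unitE: "unit_space_of G (tower C E i0 (B E)) = r ` (X \<inter> s -` B E) - A" if "E \<subseteq> F" for E
  proof -
    have "(\<Union>i\<in>E. C i i0) \<inter> s -` B E = {g \<in> X \<inter> s -` B E. r g \<notin> A}"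
      using that r_pat by (auto simp: X_def B_def)
    then show ?thesis unfolding unit_space_tower[OF m0 i0 that] by auto
  qed
  have injX: "inj_on r X" unfolding X_def by (rule inj_on_r_column[OF m0 i0])
  have unitT: "unit_space_of G T = r ` (X \<inter> s -` W) - A"
  proof -
    have "unit_space_of G T = (\<Union>E\<in>\<E>. unit_space_of G (tower C E i0 (B E)))"
      by (auto simp: T_def unit_space_of_def)
    also have "\<dots> = (\<Union>E\<in>\<E>. r ` (X \<inter> s -` B E) - A)"
      using unitE by (intro SUP_cong) (auto simp: \<E>_def)
    also have "\<dots> = r ` (X \<inter> s -` W) - A" by (auto simp: W_def)
    finally show ?thesis .
  qed
  have "folner_elementary K (4 * \<alpha>) T"
    unfolding T_def
  proof (rule folner_elementary_UN[OF finE])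
    show "disjoint_family_on (\<lambda>E. unit_space_of G (tower C E i0 (B E))) \<E>"
      unfolding disjoint_family_on_def
    proof (intro ballI impI)
      fix E E' assume E: "E \<in> \<E>" "E' \<in> \<E>" "E \<noteq> E'"
      have "g \<noteq> g'" if "g \<in> X \<inter> s -` B E" "g' \<in> X \<inter> s -` B E'" for g g'
        using that E(3) by (auto simp: B_def)
      then have "r ` (X \<inter> s -` B E) \<inter> r ` (X \<inter> s -` B E') = {}"
        using injX by (auto simp: inj_on_def)
      then show "unit_space_of G (tower C E i0 (B E)) \<inter> unit_space_of G (tower C E' i0 (B E')) = {}"
        using E unitE by (auto simp: \<E>_def)
    qed
  next
    fix E assume "E \<in> \<E>"
    then have E: "E \<subseteq> F" "(1 - \<alpha>) * real (card F) \<le> real (card E)" by (auto simp: \<E>_def)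
    show "folner_elementary K (4 * \<alpha>) (tower C E i0 (B E))"
    proof (rule folner_elementary_tower[OF ms i0 E(1) Bco[OF E(1)] K])
      fix w assume "w \<in> B E"
      then have w: "w \<in> C i0 i0" by (simp add: B_def)
      let ?P = "fib G (\<Union>i\<in>E. C i i0) w" and ?S = "fib G X w"
      have sub: "?P \<subseteq> ?S" using E by (auto simp: fib_def X_def)
      have cP: "card ?P = card E" "finite ?P" using card_fib_column[OF m0 i0 E(1) w] .
      have cS: "card ?S = card F" "finite ?S"
        using card_fib_column[OF m0 i0 order_refl w] by (auto simp: X_def)
      \<comment> \<open>Leaving the trimmed tile means either leaving the full tile or landing in
        the part that was cut off.\<close>
      have "setmul G K ?P - ?P \<subseteq> (setmul G K ?S - ?S) \<union> (?S - ?P)"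
        using sub by (auto simp: setmul_def)
      then have "card (setmul G K ?P - ?P) \<le> card ((setmul G K ?S - ?S) \<union> (?S - ?P))"
        using finite_setmul[OF K cS(2)] cS(2) by (intro card_mono) auto
      also have "\<dots> \<le> card (setmul G K ?S - ?S) + card (?S - ?P)" by (rule card_Un_le)
      finally have "real (card (setmul G K ?P - ?P)) \<le> real (card (setmul G K ?S - ?S)) + real (card (?S - ?P))"
        by linarith
      moreover have "real (card (?S - ?P)) = real (card F) - real (card E)"
        using card_Diff_subset[OF cP(2) sub] card_mono[OF cS(2) sub] cS cP by (simp add: of_nat_diff)
      ultimately have "real (card (setmul G K ?P - ?P)) \<le> \<delta> * real (card F) + real (card F) - real (card E)"
        using folner[OF w] by (simp add: X_def)
      also have "\<dots> \<le> \<alpha> * real (card F) + \<alpha> * real (card F)"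
        using E(2) mult_right_mono[OF \<alpha>(3), of "real (card F)"] by (simp add: algebra_simps)
      \<comment> \<open>Origin of the constant 4: the boundary and the cut each cost at most
        \<alpha> times \<open>card F\<close>, and \<open>card F\<close> is at most twice
        \<open>card E\<close> because \<alpha> is at most 1/2.\<close>
      also have "\<dots> = 4 * \<alpha> * (1 / 2 * real (card F))" by simp
      also have "\<dots> \<le> 4 * \<alpha> * real (card E)"
      proof (rule mult_left_mono)
        have "1 / 2 * real (card F) \<le> (1 - \<alpha>) * real (card F)"
          using \<alpha> by (intro mult_right_mono) auto
        then show "1 / 2 * real (card F) \<le> real (card E)" using E(2) by linarith
      qed (use \<alpha> in simp)
      finally show "real (card (setmul G K ?P - ?P)) \<le> 4 * \<alpha> * real (card ?P)" using cP by simp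
    qed
  qed
  moreover have "W \<subseteq> C i0 i0" by (auto simp: W_def B_def)
  moreover have "\<alpha> * real (card F) \<le> real (card {a \<in> fib G X w. r a \<in> A})" if "w \<in> C i0 i0 - W" for w
  proof -
    have w: "w \<in> C i0 i0" "real (card (pat w)) < (1 - \<alpha>) * real (card F)" using that Wiff[of w] by (simp_all add: not_le)
    have sub: "pat w \<subseteq> F" by (auto simp: pat_def)
    have "{a \<in> fib G X w. r a \<in> A} \<union> {a \<in> fib G X w. r a \<notin> A} = fib G X w" by auto
    then have "card (fib G X w) \<le> card {a \<in> fib G X w. r a \<in> A} + card {a \<in> fib G X w. r a \<notin> A}"
      using card_Un_le by metis
    also have "card {a \<in> fib G X w. r a \<notin> A} = card (pat w)"
      using card_fib_column[OF m0 i0 sub w(1)] fib_pat by simp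
    also have "card (fib G X w) = card F"
      using card_fib_column[OF m0 i0 order_refl w(1)] by (simp add: X_def)
    finally show ?thesis using w(2) by (simp add: algebra_simps)
  qed
  moreover have "(1 - \<alpha>) * real (card F) * measure \<mu> W \<le> measure \<mu> (unit_space_of G T)"
    if \<mu>: "\<mu> \<in> inv_measures G" for \<mu>
  proof -
    \<comment> \<open>The arrows of the kept tiles that survive trimming. Over each point of
      \<open>W\<close> there are at least \<open>(1 - \<alpha>) * card F\<close> of them, and
      \<open>r\<close> is injective on the column.\<close>
    let ?Y = "(X \<inter> s -` W) - (X \<inter> r -` A)"
    have "(1 - \<alpha>) * real (card F) * measure \<mu> W \<le> measure \<mu> (r ` ?Y)"
    proof (rule measure_range_ge[OF \<mu>])
      show "compact_open ?Y"
        using X Wco A by (intro compact_open_Diff compact_open_s_vimage compact_open_r_vimage)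
      show "inj_on r ?Y" using injX by (rule inj_on_subset) auto
      show "compact_open W" by (rule Wco)
      show "W \<subseteq> units G" using Wiff multisection_level[OF m0 i0] by auto
      fix u assume u: "u \<in> W"
      have sub: "pat u \<subseteq> F" by (auto simp: pat_def)
      have "fib G ?Y u = {a \<in> fib G X u. r a \<notin> A}" using u by (auto simp: fib_def)
      then show "(1 - \<alpha>) * real (card F) \<le> real (card (fib G ?Y u))"
        using u Wiff[of u] card_fib_column(1)[OF m0 i0 sub, of u] fib_pat[of u] by simp
    qed
    also have "r ` ?Y = unit_space_of G T" unfolding unitT by auto
    finally show ?thesis .
  qed
  ultimately show ?thesis using that[of T W] Wco unitT unfolding X_def by blast
qed

section \<open>Quasi-tilings\<close>

lemma multisection_imp_bisection:
  "multisection G F C \<Longrightarrow> i \<in> F \<Longrightarrow> j \<in> F \<Longrightarrow> bisection G (C i j)"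
  by (simp add: multisection_def)

lemma normal_set_eq: "normal_set G N \<Longrightarrow> nS N = (\<Union>l\<in>{1..nm N}. \<Union>i\<in>nF N l. nC N l i (ni N l))"
  and normal_set_units: "normal_set G N \<Longrightarrow> units G = (\<Union>l\<in>{1..nm N}. nC N l (ni N l) (ni N l))"
  and normal_set_disjoint: "normal_set G N \<Longrightarrow>
    disjoint_family_on (\<lambda>l. nC N l (ni N l) (ni N l)) {1..nm N}"
  and normal_set_compact_open: "normal_set G N \<Longrightarrow> compact_open (nS N)"
  unfolding normal_set_def compact_open_def by (elim conjE, assumption)+ (elim conjE, intro conjI)

lemma normal_set_multisection:
  assumes "normal_set G N" "l \<in> {1..nm N}"
  shows "co_multisection G (nF N l) (nC N l)" "multisection G (nF N l) (nC N l)"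
    "finite (nF N l)" "ni N l \<in> nF N l" "nC N l (ni N l) (ni N l) \<subseteq> units G"
proof -
  show ms: "co_multisection G (nF N l) (nC N l)" and i: "ni N l \<in> nF N l"
    using assms by (simp_all add: normal_set_def)
  then show ms': "multisection G (nF N l) (nC N l)" by (simp add: co_multisection_def)
  then show "finite (nF N l)" by (simp add: multisection_def)
  show "nC N l (ni N l) (ni N l) \<subseteq> units G" using multisection_level[OF ms' i] by blast
qed

lemma multisection_compact_open:
  assumes "normal_set G N" "l \<in> {1..nm N}" "i \<in> nF N l" "j \<in> nF N l"
  shows "compact_open (nC N l i j)"
  using normal_set_multisection(1)[OF assms(1,2)] assms(3,4)
  by (simp add: co_multisection_def compact_open_def)

lemma compact_open_units:
  assumes N: "normal_set G N" shows "compact_open (units G)"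
  unfolding normal_set_units[OF N]
  using multisection_compact_open[OF N] normal_set_multisection(4)[OF N]
  by (intro compact_open_UN) simp_all

lemma compact_open_unit_space:
  assumes "normal_set G N" "folner_elementary K e H" shows "compact_open (unit_space_of G H)"
  using assms compact_open_units elementary_compact_open
  by (auto simp: unit_space_of_def folner_elementary_def intro!: compact_open_Int)

lemma normal_set_base:
  assumes "normal_set G N" "u \<in> units G"
  obtains l where "l \<in> {1..nm N}" "u \<in> nC N l (ni N l) (ni N l)"
  using assms unfolding normal_set_units[OF assms(1)] by blast

lemma normal_set_base_unique:
  assumes "normal_set G N" "l \<in> {1..nm N}" "l' \<in> {1..nm N}"
    "u \<in> nC N l (ni N l) (ni N l)" "u \<in> nC N l' (ni N l') (ni N l')"
  shows "l = l'"
proof (rule ccontr)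
  assume "l \<noteq> l'"
  then show False using disjoint_family_onD[OF normal_set_disjoint[OF assms(1)] assms(2,3)] assms(4,5) by blast
qed

lemma normal_set_column:
  assumes N: "normal_set G N" and l: "l \<in> {1..nm N}" and w: "s a \<in> nC N l (ni N l) (ni N l)"
  shows "a \<in> nS N \<longleftrightarrow> a \<in> (\<Union>i\<in>nF N l. nC N l i (ni N l))"
proof
  note S = normal_set_eq[OF N]
  show "a \<in> nS N" if "a \<in> (\<Union>i\<in>nF N l. nC N l i (ni N l))" using that l unfolding S by blast
  assume "a \<in> nS N"
  then obtain l' i where l': "l' \<in> {1..nm N}" "i \<in> nF N l'" "a \<in> nC N l' i (ni N l')" unfolding S by blast
  have "s a \<in> nC N l' (ni N l') (ni N l')"
    using multisection_s[OF normal_set_multisection(2)[OF N l'(1)] l'(2) normal_set_multisection(4)[OF N l'(1)] l'(3)] .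
  then have "l' = l" using normal_set_base_unique[OF N l'(1) l _ w] by simp
  then show "a \<in> (\<Union>i\<in>nF N l. nC N l i (ni N l))" using l' by blast
qed

lemma fib_normal_set:
  assumes N: "normal_set G N" and l: "l \<in> {1..nm N}" and w: "w \<in> nC N l (ni N l) (ni N l)"
  shows "fib G (nS N) w = fib G (\<Union>i\<in>nF N l. nC N l i (ni N l)) w"
  using normal_set_column[OF N l] w by (auto simp: fib_def)

lemma card_nF_eq_height:
  assumes N: "normal_set G N" and c: "controlled_height 1 N" and l: "l \<in> {1..nm N}"
  shows "card (nF N l) = height N"
proof -
  have "height N \<le> card (nF N l)" unfolding height_def using l by (intro Min_le) auto
  then show ?thesis using c l by (force simp: controlled_height_def)
qed

lemma card_fib_normal_set:
  assumes N: "normal_set G N" and c: "controlled_height 1 N" and u: "u \<in> units G"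
  shows "card (fib G (nS N) u) = height N" "finite (fib G (nS N) u)" "0 < height N"
proof -
  obtain l where l: "l \<in> {1..nm N}" "u \<in> nC N l (ni N l) (ni N l)" using normal_set_base[OF N u] .
  note m = normal_set_multisection[OF N l(1)]
  show "card (fib G (nS N) u) = height N" "finite (fib G (nS N) u)"
    using card_fib_column[OF m(2,4) order_refl l(2)] card_nF_eq_height[OF N c l(1)]
    unfolding fib_normal_set[OF N l] by simp_all
  have "0 < card (nF N l)" using m(3,4) by (auto simp: card_gt_0_iff)
  then show "0 < height N" using card_nF_eq_height[OF N c l(1)] by simp
qed

text \<open>Induction on the number \<open>t\<close> of multisections already processed;
  \<open>W\<close> collects the base points of the kept tiles. Coverage of earlier tiles persists
  because the covered set only grows. The mass bound is additive because the new towers are disjoint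
  from everything covered before, and it limits the total size of the untrimmed tiles.\<close>

lemma greedy_layer:
  assumes N: "normal_set G N" and ctrl: "controlled_height 1 N" and K: "compact_open K"
    and \<alpha>: "0 < \<alpha>" "\<alpha> \<le> 1 / 2" "\<delta> \<le> \<alpha>"
    and folner: "\<forall>w\<in>units G.
      real (card (setmul G K (fib G (nS N) w) - fib G (nS N) w)) \<le> \<delta> * real (height N)"
    and H0: "folner_elementary K (4 * \<alpha>) H0"
    and t: "t \<le> nm N"
  shows "\<exists>H W. folner_elementary K (4 * \<alpha>) H \<and> compact_open W \<and> W \<subseteq> units G \<and>
    unit_space_of G H = unit_space_of G H0 \<union> r ` (nS N \<inter> s -` W) \<and>
    (\<forall>l\<in>{1..t}. \<forall>w\<in>nC N l (ni N l) (ni N l).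
      \<alpha> * real (height N) \<le> real (card {a \<in> fib G (nS N) w. r a \<in> unit_space_of G H})) \<and>
    (\<forall>\<mu>\<in>inv_measures G. (1 - \<alpha>) * real (height N) * measure \<mu> W \<le> measure \<mu> (unit_space_of G H))"
  using t
proof (induction t)
  case 0
  show ?case by (rule exI[of _ H0], rule exI[of _ "{}"]) (simp add: H0)
next
  case (Suc t)
  obtain H W where H: "folner_elementary K (4 * \<alpha>) H" and W: "compact_open W" "W \<subseteq> units G"
    and unitH: "unit_space_of G H = unit_space_of G H0 \<union> r ` (nS N \<inter> s -` W)"
    and cov: "\<forall>l\<in>{1..t}. \<forall>w\<in>nC N l (ni N l) (ni N l).
      \<alpha> * real (height N) \<le> real (card {a \<in> fib G (nS N) w. r a \<in> unit_space_of G H})"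
    and meas: "\<forall>\<mu>\<in>inv_measures G. (1 - \<alpha>) * real (height N) * measure \<mu> W \<le> measure \<mu> (unit_space_of G H)"
    using Suc.IH[OF Suc_leD[OF Suc.prems]] by (elim exE conjE) (rule that)
  let ?A = "unit_space_of G H" and ?F = "nF N (Suc t)" and ?C = "nC N (Suc t)"
    and ?i = "ni N (Suc t)" and ?S = "nS N" and ?h = "height N"
  have l: "Suc t \<in> {1..nm N}" using Suc.prems by simp
  note m = normal_set_multisection[OF N l]
  have A: "compact_open ?A" by (rule compact_open_unit_space[OF N H])
  have fol: "real (card (setmul G K (fib G (\<Union>i\<in>?F. ?C i ?i) w) - fib G (\<Union>i\<in>?F. ?C i ?i) w)) \<le> \<delta> * real (card ?F)"
    if "w \<in> ?C ?i ?i" for w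
    using bspec[OF folner subsetD[OF m(5) that]]
    unfolding card_nF_eq_height[OF N ctrl l] fib_normal_set[OF N l that] .
  obtain T V where T: "folner_elementary K (4 * \<alpha>) T" and V: "compact_open V" "V \<subseteq> ?C ?i ?i"
    and unitT: "unit_space_of G T = r ` ((\<Union>i\<in>?F. ?C i ?i) \<inter> s -` V) - ?A"
    and covT: "\<And>w. w \<in> ?C ?i ?i - V \<Longrightarrow>
      \<alpha> * real (card ?F) \<le> real (card {a \<in> fib G (\<Union>i\<in>?F. ?C i ?i) w. r a \<in> ?A})"
    and measT: "\<And>\<mu>. \<mu> \<in> inv_measures G \<Longrightarrow>
      (1 - \<alpha>) * real (card ?F) * measure \<mu> V \<le> measure \<mu> (unit_space_of G T)"
    by (rule trimmed_towers[OF m(1,4) A K \<alpha> fol]) (assumption, rule that)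
  have Vu: "V \<subseteq> units G" using V(2) m(5) by auto
  have SV: "(\<Union>i\<in>?F. ?C i ?i) \<inter> s -` V = ?S \<inter> s -` V"
    using normal_set_column[OF N l] V(2) by blast
  \<comment> \<open>Trimming does not affect the union of covered units: whatever was cut off a tile
    already lay in \<open>?A\<close>. So the covered set is described by full tiles.\<close>
  have unitHT: "unit_space_of G (H \<union> T) = ?A \<union> r ` (?S \<inter> s -` V)"
    unfolding unit_space_of_Un unitT SV by auto
  show ?case
  proof (rule exI[of _ "H \<union> T"], rule exI[of _ "W \<union> V"], intro conjI ballI)
    show "folner_elementary K (4 * \<alpha>) (H \<union> T)"
      by (rule folner_elementary_Un[OF H T]) (use unitT in auto)
    show "compact_open (W \<union> V)" "W \<union> V \<subseteq> units G" using W V(1) Vu compact_open_Un by auto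
    show "unit_space_of G (H \<union> T) = unit_space_of G H0 \<union> r ` (?S \<inter> s -` (W \<union> V))"
      unfolding unitHT unfolding unitH by auto
  next
    fix j w assume j: "j \<in> {1..Suc t}" and w: "w \<in> nC N j (ni N j) (ni N j)"
    have jm: "j \<in> {1..nm N}" using j l by auto
    have wu: "w \<in> units G" using w normal_set_multisection(5)[OF N jm] by auto
    have mono: "\<alpha> * real ?h \<le> real (card {a \<in> fib G ?S w. r a \<in> unit_space_of G (H \<union> T)})"
      if "\<alpha> * real ?h \<le> real (card {a \<in> fib G ?S w. r a \<in> ?A})"
    proof -
      have "card {a \<in> fib G ?S w. r a \<in> ?A} \<le> card {a \<in> fib G ?S w. r a \<in> unit_space_of G (H \<union> T)}"
        using card_fib_normal_set(2)[OF N ctrl wu] by (intro card_mono) (auto simp: unit_space_of_Un)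
      then show ?thesis using that by linarith
    qed
    consider "j \<in> {1..t}" | "j = Suc t" "w \<notin> V" | "w \<in> V" using j by fastforce
    then show "\<alpha> * real ?h \<le> real (card {a \<in> fib G ?S w. r a \<in> unit_space_of G (H \<union> T)})"
    proof cases
      case 1
      show ?thesis by (rule mono) (use cov 1 w in blast)
    next
      case 2
      show ?thesis
        by (rule mono) (use 2 w covT[of w] card_nF_eq_height[OF N ctrl l] fib_normal_set[OF N l, of w] in auto)
    next
      case 3
      then have "{a \<in> fib G ?S w. r a \<in> unit_space_of G (H \<union> T)} = fib G ?S w"
        unfolding unitHT by (auto simp: fib_def)
      moreover have "\<alpha> * real ?h \<le> 1 * real ?h" using \<alpha> by (intro mult_right_mono) auto
      ultimately show ?thesis using card_fib_normal_set(1)[OF N ctrl wu] by simp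
    qed
  next
    fix \<mu> assume \<mu>: "\<mu> \<in> inv_measures G"
    interpret prob_space \<mu> using \<mu> by (rule inv_measure_prob)
    have sets: "W \<in> sets \<mu>" "V \<in> sets \<mu>" "?A \<in> sets \<mu>" "unit_space_of G T \<in> sets \<mu>"
      using W V(1) Vu A compact_open_unit_space[OF N T]
      by (auto intro!: inv_measure_sets[OF \<mu>] simp: unit_space_of_def)
    have "(1 - \<alpha>) * real ?h * measure \<mu> (W \<union> V) \<le> (1 - \<alpha>) * real ?h * (measure \<mu> W + measure \<mu> V)"
      using \<alpha> sets by (intro mult_left_mono measure_Un_le mult_nonneg_nonneg) auto
    also have "\<dots> \<le> measure \<mu> ?A + measure \<mu> (unit_space_of G T)"
      using bspec[OF meas \<mu>] measT[OF \<mu>] card_nF_eq_height[OF N ctrl l] by (simp add: distrib_left)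
    also have "\<dots> = measure \<mu> (?A \<union> unit_space_of G T)"
      using sets unitT by (intro finite_measure_Union[symmetric]) auto
    finally show "(1 - \<alpha>) * real ?h * measure \<mu> (W \<union> V) \<le> measure \<mu> (unit_space_of G (H \<union> T))"
      by (simp add: unit_space_of_Un)
  qed
qed

end

text \<open>With total mass at most 1 and a union of measure at least \<open>1 - \<epsilon>\<close>,
  the sets overlap in mass at most \<epsilon>. Concretely, their parts outside \<open>A\<close> have
  total mass at least \<open>1 - \<epsilon> - prob A\<close>, which leaves at most
  \<open>prob A + \<epsilon>\<close> for the parts inside.\<close>

lemma (in prob_space) sum_prob_Int_le:
  assumes I: "finite I" and D: "\<And>i. i \<in> I \<Longrightarrow> D i \<in> events" and A: "A \<in> events"
    and total: "(\<Sum>i\<in>I. prob (D i)) \<le> 1" and cover: "1 - \<epsilon> \<le> prob (\<Union>i\<in>I. D i)"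
  shows "(\<Sum>i\<in>I. prob (D i \<inter> A)) \<le> prob A + \<epsilon>"
proof -
  have UD: "(\<Union>i\<in>I. D i - A) \<in> events"
    by (intro sets.finite_UN sets.Diff I D A)
  have "prob (\<Union>i\<in>I. D i) \<le> prob ((\<Union>i\<in>I. D i - A) \<union> A)"
    using sets.Un[OF UD A] by (intro finite_measure_mono) auto
  also have "\<dots> \<le> prob (\<Union>i\<in>I. D i - A) + prob A"
    using UD A by (rule measure_Un_le)
  also have "prob (\<Union>i\<in>I. D i - A) \<le> (\<Sum>i\<in>I. prob (D i - A))"
    using I D A by (intro finite_measure_subadditive_finite) auto
  finally have "1 - \<epsilon> - prob A \<le> (\<Sum>i\<in>I. prob (D i - A))" using cover by simp
  moreover have "(\<Sum>i\<in>I. prob (D i \<inter> A)) + (\<Sum>i\<in>I. prob (D i - A)) = (\<Sum>i\<in>I. prob (D i))"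
    unfolding sum.distrib[symmetric]
  proof (rule sum.cong[OF refl])
    fix i assume "i \<in> I"
    then show "prob (D i \<inter> A) + prob (D i - A) = prob (D i)"
      using finite_measure_Union[of "D i \<inter> A" "D i - A"] D A by (simp add: Int_Diff_Un Int_Diff_disjoint)
  qed
  ultimately show ?thesis using total by linarith
qed

section \<open>The gain of one round\<close>

context ample
begin

text \<open>Count the arrows of the tiles over \<open>Q\<close> that end in \<open>A\<close>.
  Invariance turns this count into a sum of measures of levels intersected with \<open>A\<close>.
  Since all columns have the same size, the injections \<open>f l\<close> are bijections and sort
  the levels into \<open>height N\<close> layers; each layer is almost a partition of the units, so
  it meets \<open>A\<close> in mass at most \<open>measure \<mu> A + \<epsilon>\<close>.\<close>

lemma good_covering:
  assumes N: "normal_set G N" and ctrl: "controlled_height 1 N" and good: "good G M \<epsilon> N"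
    and \<mu>: "\<mu> \<in> inv_measures G" and A: "compact_open A" "A \<subseteq> units G" and Q: "compact_open Q" "Q \<subseteq> units G"
    and count: "\<And>u. u \<in> Q \<Longrightarrow> c \<le> real (card {a \<in> fib G (nS N) u. r a \<in> A})"
  shows "c * measure \<mu> Q \<le> real (height N) * (measure \<mu> A + \<epsilon>)"
proof -
  interpret prob_space \<mu> using \<mu> by (rule inv_measure_prob)
  let ?I = "{1..nm N}" and ?h = "height N"
  note m = normal_set_multisection[OF N] and co = multisection_compact_open[OF N]
  obtain f where f0: "\<forall>l\<in>?I. inj_on (f l) {..<?h} \<and> f l ` {..<?h} \<subseteq> nF N l \<and> f l 0 = ni N l"
    and inf: "\<forall>k<?h. (INF \<mu>\<in>inv_measures G. ereal (measure \<mu> (\<Union>l\<in>?I. nC N l (f l k) (f l k)))) \<ge> ereal (1 - \<epsilon>)"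
    using good unfolding good_def by (elim exE conjE) (rule that)
  have f: "inj_on (f l) {..<?h}" "f l ` {..<?h} \<subseteq> nF N l" if "l \<in> ?I" for l
    using bspec[OF f0 that] by simp_all
  have bij: "bij_betw (f l) {..<?h} (nF N l)" if l: "l \<in> ?I" for l
  proof -
    have "card (f l ` {..<?h}) = card (nF N l)"
      using card_image[OF f(1)[OF l]] card_nF_eq_height[OF N ctrl l] by simp
    then show ?thesis
      using f(1)[OF l] card_subset_eq[OF m(3)[OF l] f(2)[OF l]] by (simp add: bij_betw_def)
  qed
  define J where "J = Sigma ?I (nF N)"
  \<comment> \<open>The base points of the column \<open>l\<close> whose \<open>i\<close>-th tile
    point lies in \<open>A\<close>.\<close>
  define X where "X = (\<lambda>(l, i). s ` (nC N l i (ni N l) \<inter> r -` A))"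
  have J: "finite J" unfolding J_def using m(3) by auto
  have levels: "r ` (nC N l i (ni N l) \<inter> r -` A) = nC N l i i \<inter> A" if li: "l \<in> ?I" "i \<in> nF N l" for l i
  proof
    show "r ` (nC N l i (ni N l) \<inter> r -` A) \<subseteq> nC N l i i \<inter> A"
      using multisection_r[OF m(2)[OF li(1)] li(2) m(4)[OF li(1)]] by auto
    show "nC N l i i \<inter> A \<subseteq> r ` (nC N l i (ni N l) \<inter> r -` A)"
    proof
      fix v assume v: "v \<in> nC N l i i \<inter> A"
      then have "v \<in> nC N l i i" by simp
      then obtain c where "c \<in> nC N l i (ni N l)" "r c = v"
        by (rule multisection_ex_r[OF m(2)[OF li(1)] li(2) m(4)[OF li(1)]])
      then show "v \<in> r ` (nC N l i (ni N l) \<inter> r -` A)" using v by auto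
    qed
  qed
  have inv: "measure \<mu> (s ` (nC N l i (ni N l) \<inter> r -` Z)) = measure \<mu> (r ` (nC N l i (ni N l) \<inter> r -` Z))"
    if "l \<in> ?I" "i \<in> nF N l" "compact_open Z" for l i Z
  proof (rule inv_measure_invariant[OF \<mu>])
    show "compact_open (nC N l i (ni N l) \<inter> r -` Z)"
      using that m(4) co by (intro compact_open_r_vimage) auto
    have "bisection G (nC N l i (ni N l))"
      by (rule multisection_imp_bisection[OF m(2)[OF that(1)] that(2) m(4)[OF that(1)]])
    then show "bisection G (nC N l i (ni N l) \<inter> r -` Z)" by (rule bisection_subset) auto
  qed
  have level_events: "nC N l i i \<in> events" if "l \<in> ?I" "i \<in> nF N l" for l i
    using that co multisection_level[OF m(2)[OF that(1)] that(2)] by (intro inv_measure_sets[OF \<mu>]) auto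
  have Aev: "A \<in> events" and Qev: "Q \<in> events" using A Q inv_measure_sets[OF \<mu>] by auto
  have base: "prob (nC N l i i) = prob (nC N l (ni N l) (ni N l))" if "l \<in> ?I" "i \<in> nF N l" for l i
  proof -
    note i0 = m(4)[OF that(1)] and ms = m(2)[OF that(1)]
    have ns: "s ` (nC N l i (ni N l)) = nC N l (ni N l) (ni N l)"
    proof (intro equalityI subsetI)
      fix v assume "v \<in> nC N l (ni N l) (ni N l)"
      then show "v \<in> s ` (nC N l i (ni N l))"
        by (rule multisection_ex_s[OF ms that(2) i0]) (auto intro: rev_image_eqI)
    qed (use multisection_s[OF ms that(2) i0] in auto)
    have nr: "r ` (nC N l i (ni N l)) = nC N l i i"
    proof (intro equalityI subsetI)
      fix v assume "v \<in> nC N l i i"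
      then show "v \<in> r ` (nC N l i (ni N l))"
        by (rule multisection_ex_r[OF ms that(2) i0]) (auto intro: rev_image_eqI)
    qed (use multisection_r[OF ms that(2) i0] in auto)
    have "bisection G (nC N l i (ni N l))"
      by (rule multisection_imp_bisection[OF m(2)[OF that(1)] that(2) m(4)[OF that(1)]])
    then show ?thesis
      using inv_measure_invariant[OF \<mu> co[OF that(1,2) m(4)[OF that(1)]]] unfolding ns nr by simp
  qed
  \<comment> \<open>The base levels partition the unit space. By invariance every layer has the same
    total mass, although its levels may overlap.\<close>
  have total: "(\<Sum>l\<in>?I. prob (nC N l (ni N l) (ni N l))) = 1"
  proof -
    have "(\<Sum>l\<in>?I. prob (nC N l (ni N l) (ni N l))) = prob (\<Union>l\<in>?I. nC N l (ni N l) (ni N l))"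
      using normal_set_disjoint[OF N] level_events m(4)
      by (intro finite_measure_finite_Union[symmetric]) auto
    also have "(\<Union>l\<in>?I. nC N l (ni N l) (ni N l)) = space \<mu>"
      using normal_set_units[OF N] inv_measure_space[OF \<mu>] by simp
    finally show ?thesis using prob_space by simp
  qed
  have layer: "(\<Sum>l\<in>?I. prob (nC N l (f l k) (f l k) \<inter> A)) \<le> prob A + \<epsilon>" if k: "k < ?h" for k
  proof (rule sum_prob_Int_le)
    have fk: "f l k \<in> nF N l" if "l \<in> ?I" for l using f(2)[OF that] k by auto
    show "nC N l (f l k) (f l k) \<in> events" if "l \<in> ?I" for l using level_events[OF that fk[OF that]] .
    show "(\<Sum>l\<in>?I. prob (nC N l (f l k) (f l k))) \<le> 1"
      using total base fk by simp
    have "ereal (1 - \<epsilon>) \<le> ereal (prob (\<Union>l\<in>?I. nC N l (f l k) (f l k)))"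
      using inf[rule_format, OF k] INF_lower[OF \<mu>] by (rule order_trans)
    then show "1 - \<epsilon> \<le> prob (\<Union>l\<in>?I. nC N l (f l k) (f l k))" by simp
  qed (use Aev in auto)
  have "c * prob Q \<le> (\<Sum>j\<in>J. prob (X j))"
  proof (rule measure_le_sum_of_count[OF J _ Qev])
    show "X j \<in> events" if "j \<in> J" for j
      using that A(1) m(4) co unfolding J_def X_def
      by (auto intro!: inv_measure_sets[OF \<mu>] compact_open_s compact_open_r_vimage)
    fix u assume u: "u \<in> Q"
    \<comment> \<open>An arrow over \<open>u\<close> is recovered from the index pair of a bisection
      containing it, so such arrows are at most as many as the pairs counted at
      \<open>u\<close>.\<close>
    have "{a \<in> fib G (nS N) u. r a \<in> A} \<subseteq> (\<lambda>(l, i). the_inv_into (nC N l i (ni N l)) s u) ` {j \<in> J. u \<in> X j}"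
    proof
      fix a assume "a \<in> {a \<in> fib G (nS N) u. r a \<in> A}"
      then have a: "a \<in> nS N" "s a = u" "r a \<in> A" by (auto simp: fib_def)
      obtain l i where li: "l \<in> ?I" "i \<in> nF N l" "a \<in> nC N l i (ni N l)"
        using a(1) unfolding normal_set_eq[OF N] by blast
      have "inj_on s (nC N l i (ni N l))"
        using multisection_imp_bisection[OF m(2)[OF li(1)] li(2) m(4)[OF li(1)]] by (simp add: bisection_def)
      then have "a = the_inv_into (nC N l i (ni N l)) s u"
        using the_inv_into_f_f li(3) a(2) by metis
      moreover have "(l, i) \<in> {j \<in> J. u \<in> X j}" using li a by (auto simp: J_def X_def)
      ultimately show "a \<in> (\<lambda>(l, i). the_inv_into (nC N l i (ni N l)) s u) ` {j \<in> J. u \<in> X j}" by force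
    qed
    then have "card {a \<in> fib G (nS N) u. r a \<in> A} \<le> card {j \<in> J. u \<in> X j}"
      using J by (intro surj_card_le) auto
    then show "c \<le> real (card {j \<in> J. u \<in> X j})" using count[OF u] by linarith
  qed
  also have "\<dots> = (\<Sum>l\<in>?I. \<Sum>i\<in>nF N l. prob (nC N l i i \<inter> A))"
  proof -
    have "prob (X (l, i)) = prob (nC N l i i \<inter> A)" if "l \<in> ?I" "i \<in> nF N l" for l i
      using inv[OF that A(1)] levels[OF that] by (simp add: X_def)
    moreover have "(\<Sum>j\<in>J. prob (X j)) = (\<Sum>l\<in>?I. \<Sum>i\<in>nF N l. prob (X (l, i)))"
      unfolding J_def using m(3) by (subst sum.Sigma) (auto simp: case_prod_beta)
    ultimately show ?thesis by simp
  qed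
  \<comment> \<open>Regroup by position \<open>k\<close> instead of by column; this is where each
    \<open>f l\<close> has to exhaust its index set.\<close>
  also have "\<dots> = (\<Sum>l\<in>?I. \<Sum>k<?h. prob (nC N l (f l k) (f l k) \<inter> A))"
    using bij by (intro sum.cong refl sum.reindex_bij_betw[symmetric])
  also have "\<dots> = (\<Sum>k<?h. \<Sum>l\<in>?I. prob (nC N l (f l k) (f l k) \<inter> A))" by (rule sum.swap)
  also have "\<dots> \<le> (\<Sum>k<?h. prob A + \<epsilon>)" using layer by (intro sum_mono) auto
  also have "\<dots> = real ?h * (prob A + \<epsilon>)" by simp
  finally show ?thesis .
qed

text \<open>For \<open>K\<close> the inverse of a normal set \<open>S\<close>, these are the points
  outside \<open>A\<close> whose \<open>S\<close>-tile meets \<open>A\<close>.\<close>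

abbreviation outer_boundary :: "'g set \<Rightarrow> 'g set \<Rightarrow> 'g set" where
  "outer_boundary K A \<equiv> r ` (K \<inter> s -` A) - A"

lemma outer_boundary_events:
  assumes "\<mu> \<in> inv_measures G" "compact_open K" "compact_open A"
  shows "outer_boundary K A \<in> sets \<mu>"
  using assms by (intro inv_measure_sets compact_open_Diff compact_open_r compact_open_s_vimage) auto

text \<open>One round multiplies the uncovered measure \<open>q\<close> by
  \<open>1 - \<alpha>\<close>. The bound \<open>bdS\<close> makes almost every uncovered base point
  usable for the count, while \<open>bdK\<close> and the Folner property of \<open>nS N\<close>
  control the boundary handed to the next round.\<close>

lemma extend_tiling:
  assumes N: "normal_set G N" and ctrl: "controlled_height 1 N" and good: "good G M \<epsilon> N" and \<epsilon>: "\<epsilon> \<le> \<delta>"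
    and K: "compact_open K" and \<alpha>: "0 < \<alpha>" "\<alpha> \<le> 1 / 2" "\<delta> \<le> \<alpha>" and \<delta>: "0 < \<delta>"
    and folner: "\<forall>w\<in>units G.
      real (card (setmul G K (fib G (nS N) w) - fib G (nS N) w)) \<le> \<delta> * real (height N)"
    and H0: "folner_elementary K (4 * \<alpha>) H0"
    and bdS: "\<And>\<mu>. \<mu> \<in> inv_measures G \<Longrightarrow>
      measure \<mu> (outer_boundary (ginv G ` nS N) (unit_space_of G H0)) \<le> \<delta>"
    and bdK: "\<And>\<mu>. \<mu> \<in> inv_measures G \<Longrightarrow> measure \<mu> (outer_boundary K (unit_space_of G H0)) \<le> \<delta>"
    and rest: "\<And>\<mu>. \<mu> \<in> inv_measures G \<Longrightarrow> 1 - measure \<mu> (unit_space_of G H0) \<le> q + \<delta>"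
  obtains H where "folner_elementary K (4 * \<alpha>) H"
    "\<And>\<mu>. \<mu> \<in> inv_measures G \<Longrightarrow> 1 - measure \<mu> (unit_space_of G H) \<le> (1 - \<alpha>) * q + 3 * \<delta>"
    "\<And>\<mu>. \<mu> \<in> inv_measures G \<Longrightarrow> measure \<mu> (outer_boundary K (unit_space_of G H)) \<le> 3 * \<delta>"
proof -
  let ?S = "nS N" and ?h = "height N" and ?D = "unit_space_of G H0"
  obtain H W where H: "folner_elementary K (4 * \<alpha>) H" and W: "compact_open W" "W \<subseteq> units G"
    and unitH: "unit_space_of G H = ?D \<union> r ` (?S \<inter> s -` W)"
    and cov: "\<forall>l\<in>{1..nm N}. \<forall>w\<in>nC N l (ni N l) (ni N l).
      \<alpha> * real ?h \<le> real (card {a \<in> fib G ?S w. r a \<in> unit_space_of G H})"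
    and meas: "\<forall>\<mu>\<in>inv_measures G. (1 - \<alpha>) * real ?h * measure \<mu> W \<le> measure \<mu> (unit_space_of G H)"
    using greedy_layer[OF N ctrl K \<alpha> folner H0 order_refl] by (elim exE conjE) (rule that)
  let ?A = "unit_space_of G H"
  have A: "compact_open ?A" "?A \<subseteq> units G" and A0: "compact_open ?D" "?D \<subseteq> units G"
    using compact_open_unit_space[OF N H] compact_open_unit_space[OF N H0] by (auto simp: unit_space_of_def)
  have S: "compact_open ?S" and Si: "compact_open (ginv G ` ?S)" and U: "compact_open (units G)"
    using normal_set_compact_open[OF N] compact_open_ginv compact_open_units[OF N] by auto
  \<comment> \<open>A unit exists since the carrier is a whole type: the source of any
    arrow.\<close>
  have hpos: "0 < ?h" using card_fib_normal_set(3)[OF N ctrl s_in_units] .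
  have "1 - measure \<mu> ?A \<le> (1 - \<alpha>) * q + 3 * \<delta>" if \<mu>: "\<mu> \<in> inv_measures G" for \<mu>
  proof -
    interpret prob_space \<mu> using \<mu> by (rule inv_measure_prob)
    let ?out = "outer_boundary (ginv G ` ?S) ?D"
    \<comment> \<open>Uncovered base points whose tile misses \<open>?D\<close> entirely.\<close>
    let ?Q = "units G - ?D - ?out"
    have out: "compact_open ?out" using A0 Si
      by (intro compact_open_Diff compact_open_r compact_open_s_vimage) auto
    have ev: "?A \<in> events" "?D \<in> events" "?out \<in> events" "units G \<in> events"
      using A A0 out U by (auto intro!: inv_measure_sets[OF \<mu>])
    \<comment> \<open>The count is applied to \<open>?A - ?D\<close>, so that it measures the gain;
      over \<open>?Q\<close> nothing is lost by removing \<open>?D\<close>.\<close>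
    have "\<alpha> * real ?h * prob ?Q \<le> real ?h * (prob (?A - ?D) + \<epsilon>)"
    proof (rule good_covering[OF N ctrl good \<mu>])
      show "compact_open (?A - ?D)" "?A - ?D \<subseteq> units G" using A A0 compact_open_Diff by auto
      show "compact_open ?Q" "?Q \<subseteq> units G" using U A0 out by (auto intro!: compact_open_Diff)
      fix u assume u: "u \<in> ?Q"
      have "r a \<notin> ?D" if "a \<in> fib G ?S u" for a
      proof
        assume "r a \<in> ?D"
        then have "ginv G a \<in> ginv G ` ?S \<inter> s -` ?D" using that by (auto simp: fib_def)
        moreover have "u = r (ginv G a)" using that by (simp add: fib_def)
        ultimately have "u \<in> r ` (ginv G ` ?S \<inter> s -` ?D)" by blast
        then show False using u by blast
      qed
      then have eq: "{a \<in> fib G ?S u. r a \<in> ?A - ?D} = {a \<in> fib G ?S u. r a \<in> ?A}" by auto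
      have "u \<in> units G" using u by simp
      then obtain l where "l \<in> {1..nm N}" "u \<in> nC N l (ni N l) (ni N l)"
        by (rule normal_set_base[OF N])
      then show "\<alpha> * real ?h \<le> real (card {a \<in> fib G ?S u. r a \<in> ?A - ?D})"
        unfolding eq by (rule cov[rule_format])
    qed
    then have "\<alpha> * prob ?Q \<le> prob (?A - ?D) + \<epsilon>" using hpos by (simp add: mult.assoc mult.left_commute)
    moreover have "prob (?A - ?D) = prob ?A - prob ?D"
      using ev unitH by (intro finite_measure_Diff) auto
    moreover have "1 - prob ?D - \<delta> \<le> prob ?Q"
    proof -
      have "prob (units G - ?D) = 1 - prob ?D"
        using prob_compl[OF ev(2)] inv_measure_space[OF \<mu>] by simp
      moreover have "prob (units G - ?D) \<le> prob (?Q \<union> ?out)"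
        using ev by (intro finite_measure_mono) auto
      moreover have "prob (?Q \<union> ?out) \<le> prob ?Q + prob ?out"
        using ev by (intro measure_Un_le) auto
      ultimately show ?thesis using bdS[OF \<mu>] by linarith
    qed
    then have "\<alpha> * (1 - prob ?D - \<delta>) \<le> \<alpha> * prob ?Q" using \<alpha> by (intro mult_left_mono) auto
    ultimately have "\<alpha> * (1 - prob ?D - \<delta>) \<le> prob ?A - prob ?D + \<delta>" using \<epsilon> by linarith
    then have "1 - prob ?A \<le> (1 - \<alpha>) * (1 - prob ?D) + \<delta> + \<alpha> * \<delta>" by (simp add: algebra_simps)
    also have "\<dots> \<le> (1 - \<alpha>) * (q + \<delta>) + \<delta> + \<alpha> * \<delta>"
      using rest[OF \<mu>] \<alpha> by (intro add_right_mono mult_left_mono) auto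
    \<comment> \<open>The sum is exactly \<open>(1 - \<alpha>) * q + 2 * \<delta>\<close>. The
      factor 3 is dictated by the boundary estimate: \<delta> from the old boundary and twice
      \<delta> from the new tiles.\<close>
    also have "\<dots> \<le> (1 - \<alpha>) * q + 3 * \<delta>" using \<delta> by (simp add: algebra_simps)
    finally show ?thesis .
  qed
  moreover have "measure \<mu> (outer_boundary K ?A) \<le> 3 * \<delta>" if \<mu>: "\<mu> \<in> inv_measures G" for \<mu>
  proof -
    interpret prob_space \<mu> using \<mu> by (rule inv_measure_prob)
    \<comment> \<open>The arrows by which \<open>K\<close> leaves the kept tiles. Since the covered
      set contains these tiles in full, any new boundary point is the range of such an
      arrow.\<close>
    let ?Y = "setmul G K (?S \<inter> s -` W) - ?S"
    have Y: "compact_open ?Y"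
      using K S W by (intro compact_open_Diff compact_open_setmul compact_open_s_vimage)
    have "outer_boundary K ?A \<subseteq> outer_boundary K ?D \<union> r ` ?Y"
    proof
      fix v assume "v \<in> outer_boundary K ?A"
      then obtain k where k: "k \<in> K" "s k \<in> ?A" "v = r k" "r k \<notin> ?A" by auto
      show "v \<in> outer_boundary K ?D \<union> r ` ?Y"
      proof (cases "s k \<in> ?D")
        case True
        then show ?thesis using k unitH by auto
      next
        case False
        then obtain a where a: "a \<in> ?S" "s a \<in> W" "s k = r a" using k unitH by auto
        have "k \<odot> a \<notin> ?S"
        proof
          assume "k \<odot> a \<in> ?S"
          then have "k \<odot> a \<in> ?S \<inter> s -` W" using a by simp
          then have "r (k \<odot> a) \<in> ?A" unfolding unitH by blast
          then show False using k a by simp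
        qed
        then have "k \<odot> a \<in> ?Y" using k a by (auto simp: setmul_def)
        moreover have "r (k \<odot> a) = v" using k a by simp
        ultimately show ?thesis by blast
      qed
    qed
    moreover have ev: "outer_boundary K ?D \<in> events" "r ` ?Y \<in> events"
      using outer_boundary_events[OF \<mu> K A0(1)] Y by (auto intro!: inv_measure_sets[OF \<mu>] compact_open_r)
    ultimately have "prob (outer_boundary K ?A) \<le> prob (outer_boundary K ?D \<union> r ` ?Y)"
      by (intro finite_measure_mono) auto
    also have "\<dots> \<le> prob (outer_boundary K ?D) + prob (r ` ?Y)" using ev by (rule measure_Un_le)
    also have "prob (r ` ?Y) \<le> \<delta> * real ?h * prob W"
    proof (rule measure_range_le[OF \<mu> Y W])
      show "s ` ?Y \<subseteq> W" by (auto simp: setmul_def)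
      fix u assume u: "u \<in> W"
      have fin: "finite (fib G ?S u)" using finite_fib[OF S] .
      have "fib G ?Y u \<subseteq> setmul G K (fib G ?S u) - fib G ?S u"
      proof
        fix c assume "c \<in> fib G ?Y u"
        then obtain k a where "k \<in> K" "a \<in> ?S" "s k = r a" "c = k \<odot> a" "c \<notin> ?S" "s c = u"
          by (auto simp: fib_def setmul_def)
        moreover from this have "a \<in> fib G ?S u" by (simp add: fib_def)
        ultimately show "c \<in> setmul G K (fib G ?S u) - fib G ?S u"
          by (auto simp: setmul_def fib_def)
      qed
      then have "card (fib G ?Y u) \<le> card (setmul G K (fib G ?S u) - fib G ?S u)"
        using finite_setmul[OF K fin] by (intro card_mono) auto
      then show "real (card (fib G ?Y u)) \<le> \<delta> * real ?h"
        using bspec[OF folner subsetD[OF W(2) u]] by linarith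
    qed
    \<comment> \<open>Because \<open>1 - \<alpha>\<close> is at least 1/2, the mass of the full
      tiles is at most twice that of the trimmed ones, which is bounded by 1.\<close>
    also have "\<delta> * real ?h * prob W \<le> \<delta> * (2 * ((1 - \<alpha>) * real ?h * prob W))"
    proof -
      have "1 * (real ?h * prob W) \<le> (2 * (1 - \<alpha>)) * (real ?h * prob W)"
        using \<alpha> by (intro mult_right_mono) auto
      then have "\<delta> * (1 * (real ?h * prob W)) \<le> \<delta> * ((2 * (1 - \<alpha>)) * (real ?h * prob W))"
        using \<delta> by (intro mult_left_mono) auto
      then show ?thesis by (simp only: mult.assoc mult_1_left)
    qed
    also have "\<dots> \<le> \<delta> * (2 * 1)"
      using order_trans[OF bspec[OF meas \<mu>] prob_le_1] \<delta> by (intro mult_left_mono) auto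
    finally show ?thesis using bdK[OF \<mu>] by simp
  qed
  ultimately show ?thesis using that[OF H] by blast
qed

section \<open>Iteration and conclusion\<close>

lemma folner_elementary_mono:
  assumes H: "folner_elementary K' e H" and K: "K \<subseteq> K'" and K': "compact_open K'"
  shows "folner_elementary K e H"
  unfolding folner_elementary_def
proof (intro conjI ballI)
  show el: "elementary_subgroupoid G H" using H by (simp add: folner_elementary_def)
  fix u assume u: "u \<in> unit_space_of G H"
  let ?P = "fib G H u"
  have "finite (setmul G K' ?P)" using finite_setmul[OF K'] finite_fib elementary_compact_open[OF el] by blast
  then have "card (setmul G K ?P - ?P) \<le> card (setmul G K' ?P - ?P)"
    using K by (intro card_mono) (auto simp: setmul_def)
  also have "real \<dots> \<le> e * real (card ?P)" using H u by (simp add: folner_elementary_def)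
  finally show "real (card (setmul G K ?P - ?P)) \<le> e * real (card ?P)" by simp
qed

text \<open>A supremum below \<delta> bounds all fibre quotients at once, and equal heights replace
  the fibre size by a denominator that does not depend on the unit.\<close>

lemma folner_sequence_eventually:
  assumes S: "folner_sequence G S" and c: "\<And>n. controlled_height 1 (S n)"
    and K: "compact K" and \<delta>: "0 < \<delta>"
  shows "eventually (\<lambda>n. \<forall>u\<in>units G.
    real (card (setmul G K (fib G (nS (S n)) u) - fib G (nS (S n)) u)) \<le> \<delta> * real (height (S n))) sequentially"
proof -
  let ?q = "\<lambda>n u. ereal (real (card (setmul G K (fib G (nS (S n)) u) - fib G (nS (S n)) u))
                                    / real (card (fib G (nS (S n)) u)))"
  have "(\<lambda>n. SUP u\<in>units G. ?q n u) \<longlonglongrightarrow> 0" using S K unfolding folner_sequence_def by blast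
  then have "eventually (\<lambda>n. (SUP u\<in>units G. ?q n u) < ereal \<delta>) sequentially"
    by (rule order_tendstoD(2)) (use \<delta> in simp)
  then show ?thesis
  proof eventually_elim
    case (elim n)
    show ?case
    proof
      fix u assume u: "u \<in> units G"
      have N: "normal_set G (S n)" using S unfolding folner_sequence_def by blast
      note h = card_fib_normal_set[OF N c u]
      have "?q n u < ereal \<delta>" using SUP_upper[OF u, of "?q n"] elim by (rule le_less_trans)
      then show "real (card (setmul G K (fib G (nS (S n)) u) - fib G (nS (S n)) u)) \<le> \<delta> * real (height (S n))"
        using h by (simp add: pos_divide_less_eq)
    qed
  qed
qed

text \<open>\<open>K\<close> and \<delta> must vary in the induction: the set \<open>S n\<close> of
  the last round is chosen first, and the earlier rounds are then required to be almost invariant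
  under \<open>K\<close> together with the inverse of \<open>S n\<close>. With no rounds, the empty
  tiling leaves measure at most 1, which is \<open>(1 - \<alpha>) ^ 0\<close>.\<close>

lemma tilings:
  assumes S: "folner_sequence G S" and \<epsilon>: "\<epsilon> \<longlonglongrightarrow> 0"
    and good: "\<And>n. good G M (\<epsilon> n) (S n)" and ctrl: "\<And>n. controlled_height 1 (S n)"
    and \<alpha>: "0 < \<alpha>" "\<alpha> \<le> 1 / 2" and K: "compact_open K" and \<delta>: "0 < \<delta>"
  shows "\<exists>H. folner_elementary K (4 * \<alpha>) H \<and>
    (\<forall>\<mu>\<in>inv_measures G. 1 - measure \<mu> (unit_space_of G H) \<le> (1 - \<alpha>) ^ m + \<delta>) \<and>
    (\<forall>\<mu>\<in>inv_measures G. measure \<mu> (outer_boundary K (unit_space_of G H)) \<le> \<delta>)"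
  using K \<delta>
proof (induction m arbitrary: K \<delta>)
  case 0
  then show ?case
    by (intro exI[of _ "{}"]) (simp add: folner_elementary_empty unit_space_of_def)
next
  case (Suc m)
  \<comment> \<open>Division by 3 absorbs the error factor of \<open>extend_tiling\<close>; the cap
    at \<alpha> is required for trimming.\<close>
  define \<eta> where "\<eta> = min (\<delta> / 3) \<alpha>"
  have \<eta>: "0 < \<eta>" "3 * \<eta> \<le> \<delta>" "\<eta> \<le> \<alpha>" using Suc.prems \<alpha> by (auto simp: \<eta>_def)
  have "eventually (\<lambda>n. \<epsilon> n < \<eta>) sequentially" by (rule order_tendstoD(2)[OF \<epsilon> \<eta>(1)])
  moreover have "compact K" using Suc.prems by (simp add: compact_open_def)
  ultimately have "eventually (\<lambda>n. \<epsilon> n < \<eta> \<and> (\<forall>u\<in>units G.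
    real (card (setmul G K (fib G (nS (S n)) u) - fib G (nS (S n)) u)) \<le> \<eta> * real (height (S n)))) sequentially"
    using folner_sequence_eventually[OF S ctrl _ \<eta>(1)] by (intro eventually_conj)
  then obtain n where n: "\<epsilon> n < \<eta>" and fol: "\<forall>u\<in>units G.
    real (card (setmul G K (fib G (nS (S n)) u) - fib G (nS (S n)) u)) \<le> \<eta> * real (height (S n))"
    unfolding eventually_sequentially by blast
  have N: "normal_set G (S n)" using S unfolding folner_sequence_def by blast
  have Si: "compact_open (ginv G ` nS (S n))" by (rule compact_open_ginv[OF normal_set_compact_open[OF N]])
  \<comment> \<open>One enlarged set supplies both boundary hypotheses of
    \<open>extend_tiling\<close>, since outer boundaries are monotone in the set of arrows.\<close>
  let ?K = "K \<union> ginv G ` nS (S n)"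
  have K': "compact_open ?K" by (rule compact_open_Un[OF Suc.prems(1) Si])
  obtain H0 where H0: "folner_elementary ?K (4 * \<alpha>) H0"
    and rest: "\<And>\<mu>. \<mu> \<in> inv_measures G \<Longrightarrow> 1 - measure \<mu> (unit_space_of G H0) \<le> (1 - \<alpha>) ^ m + \<eta>"
    and bd: "\<And>\<mu>. \<mu> \<in> inv_measures G \<Longrightarrow> measure \<mu> (outer_boundary ?K (unit_space_of G H0)) \<le> \<eta>"
    using Suc.IH[OF K' \<eta>(1)] by blast
  have A0: "compact_open (unit_space_of G H0)" by (rule compact_open_unit_space[OF N H0])
  have bd': "measure \<mu> (outer_boundary L (unit_space_of G H0)) \<le> \<eta>"
    if \<mu>: "\<mu> \<in> inv_measures G" and L: "L \<subseteq> ?K" for \<mu> L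
  proof -
    interpret prob_space \<mu> using \<mu> by (rule inv_measure_prob)
    have "prob (outer_boundary L (unit_space_of G H0)) \<le> prob (outer_boundary ?K (unit_space_of G H0))"
      using outer_boundary_events[OF \<mu> K' A0] L by (intro finite_measure_mono) auto
    then show ?thesis using bd[OF \<mu>] by linarith
  qed
  obtain H where "folner_elementary K (4 * \<alpha>) H"
    "\<And>\<mu>. \<mu> \<in> inv_measures G \<Longrightarrow> 1 - measure \<mu> (unit_space_of G H) \<le> (1 - \<alpha>) * (1 - \<alpha>) ^ m + 3 * \<eta>"
    "\<And>\<mu>. \<mu> \<in> inv_measures G \<Longrightarrow> measure \<mu> (outer_boundary K (unit_space_of G H)) \<le> 3 * \<eta>"
  proof (rule extend_tiling[OF N ctrl good _ Suc.prems(1) \<alpha> \<eta>(3,1) fol])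
    show "\<epsilon> n \<le> \<eta>" using n by simp
    show "folner_elementary K (4 * \<alpha>) H0" by (rule folner_elementary_mono[OF H0 _ K']) simp
    show "measure \<mu> (outer_boundary (ginv G ` nS (S n)) (unit_space_of G H0)) \<le> \<eta>"
      if "\<mu> \<in> inv_measures G" for \<mu> by (rule bd'[OF that]) simp
    show "measure \<mu> (outer_boundary K (unit_space_of G H0)) \<le> \<eta>"
      if "\<mu> \<in> inv_measures G" for \<mu> by (rule bd'[OF that]) simp
    show "1 - measure \<mu> (unit_space_of G H0) \<le> (1 - \<alpha>) ^ m + \<eta>"
      if "\<mu> \<in> inv_measures G" for \<mu> by (rule rest[OF that])
  qed (rule that)
  then show ?case using \<eta>(2) by (intro exI[of _ H]) force
qed

lemma almost_finite_in_measure: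
  assumes S: "folner_sequence G S" and \<epsilon>: "\<epsilon> \<longlonglongrightarrow> 0"
    and good: "\<And>n. good G M (\<epsilon> n) (S n)" and ctrl: "\<And>n. controlled_height 1 (S n)"
  shows "almost_finite_in_measure G"
  unfolding almost_finite_in_measure_def
proof (intro allI impI, elim conjE)
  fix K and \<delta> :: real
  assume K: "compact (K :: 'g set)" and \<delta>: "\<delta> > 0"
  obtain K' where K': "compact_open K'" "K \<subseteq> K'" using compact_subset_compact_open[OF K] .
  \<comment> \<open>The Folner constant \<open>4 * \<alpha>\<close> is then at most half of
    \<delta>, and \<alpha> stays below 1/2 for large \<delta> as well.\<close>
  define \<alpha> where "\<alpha> = min \<delta> 1 / 8"
  have \<alpha>: "0 < \<alpha>" "\<alpha> \<le> 1 / 2" "4 * \<alpha> < \<delta>" using \<delta> by (auto simp: \<alpha>_def)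
  \<comment> \<open>Together with the error \<open>\<delta> / 4\<close> of the tiling, the remainder
    stays below \<delta> for every invariant measure, with \<open>m\<close> chosen independently of
    the measure.\<close>
  obtain m where m: "(1 - \<alpha>) ^ m < \<delta> / 2"
    using real_arch_pow_inv[of "\<delta> / 2" "1 - \<alpha>"] \<alpha> \<delta> by auto
  obtain H where H': "folner_elementary K' (4 * \<alpha>) H"
    and rest: "\<forall>\<mu>\<in>inv_measures G. 1 - measure \<mu> (unit_space_of G H) \<le> (1 - \<alpha>) ^ m + \<delta> / 4"
    using tilings[OF S \<epsilon> good ctrl \<alpha>(1,2) K'(1), of "\<delta> / 4" m] \<delta> by auto
  have H: "folner_elementary K (4 * \<alpha>) H" by (rule folner_elementary_mono[OF H' K'(2,1)])
  have el: "elementary_subgroupoid G H" using H by (simp add: folner_elementary_def)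
  show "\<exists>H. elementary_subgroupoid G H \<and>
           (\<forall>u\<in>unit_space_of G H.
              real (card (setmul G K (fib G H u) - fib G H u)) < \<delta> * real (card (fib G H u))) \<and>
           (\<forall>\<mu>\<in>inv_measures G. measure \<mu> (unit_space_of G H) > 1 - \<delta>)"
  proof (intro exI[of _ H] conjI ballI el)
    fix u assume u: "u \<in> unit_space_of G H"
    then have "u \<in> fib G H u" using s_unit by (simp add: unit_space_of_def fib_def)
    moreover have "finite (fib G H u)" by (rule finite_fib[OF elementary_compact_open[OF el]])
    ultimately have "0 < card (fib G H u)" by (auto simp: card_gt_0_iff)
    then have "4 * \<alpha> * real (card (fib G H u)) < \<delta> * real (card (fib G H u))" using \<alpha> by simp
    then show "real (card (setmul G K (fib G H u) - fib G H u)) < \<delta> * real (card (fib G H u))"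
      using H u unfolding folner_elementary_def by force
  next
    fix \<mu> assume "\<mu> \<in> inv_measures G"
    then show "measure \<mu> (unit_space_of G H) > 1 - \<delta>" using rest m \<delta> by force
  qed
qed

end

theorem theoremA:
  fixes G :: "('g::t2_space) groupoid"
    and M :: nat
    and \<epsilon> :: "nat \<Rightarrow> real"
    and S :: "nat \<Rightarrow> 'g normal_data"
  assumes "ample_groupoid G"
    and "decseq \<epsilon>"
    and "\<forall>n. \<epsilon> n > 0"
    and "\<epsilon> \<longlonglongrightarrow> 0"
    and "folner_sequence G S"
    and "\<forall>n. good G M (\<epsilon> n) (S n) \<and> controlled_height 1 (S n)"
  shows "almost_finite_in_measure G"
proof -
  interpret ample G using assms(1) by unfold_locales
  show ?thesis by (rule almost_finite_in_measure[OF assms(5,4)]) (use assms(6) in blast)+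
qed

end
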